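(* Let $G$ be a finite solvable group. Then (NPQ) holds for $G$.
   Context: For a group $X$ (possibly infinite), $\pi(X)$ denotes the set of primes $p$ such that $X$ has an element of order $p$. The N-prime graph $\Gamma_{\mathrm N}(X)$ of $X$ is the simple directed graph with vertex set $\pi(X)$ in which, for distinct vertices $p$ and $q$, there is an arc $q\rightarrow p$ if and only if there exists an element $x\in X$ of order $p$ such that $\langle x\rangle$ is normalized by some element $y\in X$ of order $q$. For a finite group $G$, $V(\mathbb{Z}G)$ denotes the group of units of augmentation $1$ in the integral group ring $\mathbb{Z}G$. We say that (NPQ) holds for a finite group $G$ if $\Gamma_{\mathrm N}(G)=\Gamma_{\mathrm N}(V(\mathbb{Z}G))$. *)

theory Defs
  imports
    "HOL-Algebra.Solvable_Groups"
    "HOL-Algebra.Group_Action"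
    "HOL-Algebra.Multiplicative_Group"
    "HOL-Computational_Algebra.Primes"
    "Graph_Theory.Pair_Digraph"
begin

definition prime_spectrum :: "('a, 'b) monoid_scheme \<Rightarrow> nat set" where
  "prime_spectrum X = {p. prime p \<and> (\<exists>x \<in> carrier X. group.ord X x = p)}"

definition N_prime_graph :: "('a, 'b) monoid_scheme \<Rightarrow> nat pair_pre_digraph" where
  "N_prime_graph X = \<lparr>
     pverts = prime_spectrum X,
     parcs = {(q, p). q \<in> prime_spectrum X \<and> p \<in> prime_spectrum X \<and> q \<noteq> p \<and>
       (\<exists>x \<in> carrier X. \<exists>y \<in> carrier X. group.ord X x = p \<and> group.ord X y = q \<and>
          y \<in> normalizer X (generate X {x}))}\<rparr>"

text \<open>
  The integral group ring of a finite group: an element is its coefficient function,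
  set to zero outside the carrier so that equality of ring elements is equality of functions.
  The underlying group has to be finite, since the sums range over its whole carrier.
\<close>

definition int_group_ring :: "('a, 'b) monoid_scheme \<Rightarrow> ('a \<Rightarrow> int) ring" where
  "int_group_ring G = \<lparr>
     carrier = {f. \<forall>g. g \<notin> carrier G \<longrightarrow> f g = 0},
     monoid.mult = (\<lambda>f f' g. \<Sum>(h, k) \<in> {(h, k) \<in> carrier G \<times> carrier G. h \<otimes>\<^bsub>G\<^esub> k = g}. f h * f' k),
     one = (\<lambda>g. if g = \<one>\<^bsub>G\<^esub> then 1 else 0),
     zero = (\<lambda>g. 0),
     add = (\<lambda>f f' g. f g + f' g)\<rparr>"

definition augmentation :: "('a, 'b) monoid_scheme \<Rightarrow> ('a \<Rightarrow> int) \<Rightarrow> int" where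
  "augmentation G f = (\<Sum>g \<in> carrier G. f g)"

definition normalized_units :: "('a, 'b) monoid_scheme \<Rightarrow> ('a \<Rightarrow> int) monoid" where
  "normalized_units G =
     units_of (int_group_ring G)
       \<lparr>carrier := {u \<in> Units (int_group_ring G). augmentation G u = 1}\<rparr>"

definition NPQ :: "('a, 'b) monoid_scheme \<Rightarrow> bool" where
  "NPQ G \<longleftrightarrow> N_prime_graph G = N_prime_graph (normalized_units G)"

text \<open>
  The library's \<open>group.ord\<close> is only characterised on groups; the following facts show that
  it is applied to a group here.
\<close>

context group
begin

lemma int_group_ring_mult:
  assumes "finite (carrier G)"
  shows "(f \<otimes>\<^bsub>int_group_ring G\<^esub> f') g =
    (\<Sum>h \<in> carrier G. \<Sum>k \<in> carrier G. if h \<otimes> k = g then f h * f' k else 0)"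
proof -
  have "(f \<otimes>\<^bsub>int_group_ring G\<^esub> f') g =
      (\<Sum>z \<in> {z \<in> carrier G \<times> carrier G. fst z \<otimes> snd z = g}. f (fst z) * f' (snd z))"
    unfolding int_group_ring_def by (auto simp: case_prod_beta intro!: sum.cong)
  also have "\<dots> = (\<Sum>z \<in> carrier G \<times> carrier G.
      if fst z \<otimes> snd z = g then f (fst z) * f' (snd z) else 0)"
    using assms by (intro sum.inter_filter) simp
  finally show ?thesis
    by (simp add: sum.cartesian_product case_prod_beta)
qed

lemma int_group_ring_mult':
  assumes "finite (carrier G)" "g \<in> carrier G"
  shows "(f \<otimes>\<^bsub>int_group_ring G\<^esub> f') g = (\<Sum>h \<in> carrier G. f h * f' (inv h \<otimes> g))"
proof -
  have "(\<Sum>k \<in> carrier G. if h \<otimes> k = g then f h * f' k else 0) = f h * f' (inv h \<otimes> g)"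
    if h: "h \<in> carrier G" for h
  proof -
    have "h \<otimes> k = g \<longleftrightarrow> k = inv h \<otimes> g" if "k \<in> carrier G" for k
      using that h assms(2) by (metis inv_closed inv_solve_left)
    then have "(\<Sum>k \<in> carrier G. if h \<otimes> k = g then f h * f' k else 0) =
        (\<Sum>k \<in> carrier G. if k = inv h \<otimes> g then f h * f' k else 0)"
      by (intro sum.cong) auto
    then show ?thesis
      using assms h by (simp add: sum.delta)
  qed
  then show ?thesis
    by (simp add: int_group_ring_mult[OF assms(1)])
qed

lemma int_group_ring_mult_outside:
  assumes "g \<notin> carrier G"
  shows "(f \<otimes>\<^bsub>int_group_ring G\<^esub> f') g = 0"
  using assms unfolding int_group_ring_def by (auto intro!: sum.neutral)

lemma int_group_ring_assoc:
  assumes fin: "finite (carrier G)"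
  shows "(a \<otimes>\<^bsub>int_group_ring G\<^esub> b) \<otimes>\<^bsub>int_group_ring G\<^esub> c =
    a \<otimes>\<^bsub>int_group_ring G\<^esub> (b \<otimes>\<^bsub>int_group_ring G\<^esub> c)"
proof
  fix g
  show "((a \<otimes>\<^bsub>int_group_ring G\<^esub> b) \<otimes>\<^bsub>int_group_ring G\<^esub> c) g =
    (a \<otimes>\<^bsub>int_group_ring G\<^esub> (b \<otimes>\<^bsub>int_group_ring G\<^esub> c)) g"
  proof (cases "g \<in> carrier G")
    case g: True
    have "((a \<otimes>\<^bsub>int_group_ring G\<^esub> b) \<otimes>\<^bsub>int_group_ring G\<^esub> c) g =
        (\<Sum>k \<in> carrier G. (\<Sum>h \<in> carrier G. a h * b (inv h \<otimes> k)) * c (inv k \<otimes> g))"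
      using g fin by (simp add: int_group_ring_mult')
    also have "\<dots> = (\<Sum>h \<in> carrier G. \<Sum>k \<in> carrier G. a h * b (inv h \<otimes> k) * c (inv k \<otimes> g))"
      by (simp only: sum_distrib_right) (rule sum.swap)
    also have "\<dots> = (\<Sum>h \<in> carrier G. \<Sum>k \<in> carrier G. a h * b k * c (inv k \<otimes> (inv h \<otimes> g)))"
    proof (rule sum.cong[OF refl])
      fix h assume h: "h \<in> carrier G"
      have cancel: "h \<otimes> (inv h \<otimes> x) = x" "inv h \<otimes> (h \<otimes> x) = x" if "x \<in> carrier G" for x
        using h that by (simp_all add: m_assoc[symmetric])
      show "(\<Sum>k \<in> carrier G. a h * b (inv h \<otimes> k) * c (inv k \<otimes> g)) =
          (\<Sum>k \<in> carrier G. a h * b k * c (inv k \<otimes> (inv h \<otimes> g)))"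
        by (rule sum.reindex_bij_witness[where i = "\<lambda>k. h \<otimes> k" and j = "\<lambda>k. inv h \<otimes> k"])
          (use g h cancel in \<open>auto simp: inv_mult_group m_assoc\<close>)
    qed
    also have "\<dots> = (a \<otimes>\<^bsub>int_group_ring G\<^esub> (b \<otimes>\<^bsub>int_group_ring G\<^esub> c)) g"
      using g fin by (simp add: int_group_ring_mult' sum_distrib_left mult.assoc)
    finally show ?thesis .
  qed (simp add: int_group_ring_mult_outside)
qed

lemma ring_int_group_ring:
  assumes fin: "finite (carrier G)"
  shows "ring (int_group_ring G)"
proof (rule ringI)
  show "abelian_group (int_group_ring G)"
  proof (rule abelian_groupI)
    fix f assume "f \<in> carrier (int_group_ring G)"
    then show "\<exists>f' \<in> carrier (int_group_ring G).
        f' \<oplus>\<^bsub>int_group_ring G\<^esub> f = \<zero>\<^bsub>int_group_ring G\<^esub>"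
      by (intro bexI[of _ "\<lambda>g. - f g"]) (auto simp: int_group_ring_def)
  qed (auto simp: int_group_ring_def)
  show "Group.monoid (int_group_ring G)"
  proof (rule monoidI)
    fix f f' assume "f \<in> carrier (int_group_ring G)" "f' \<in> carrier (int_group_ring G)"
    show "f \<otimes>\<^bsub>int_group_ring G\<^esub> f' \<in> carrier (int_group_ring G)"
      using int_group_ring_mult_outside[of _ f f'] by (simp add: int_group_ring_def)
  next
    show "\<one>\<^bsub>int_group_ring G\<^esub> \<in> carrier (int_group_ring G)"
      by (auto simp: int_group_ring_def)
  next
    fix f assume f: "f \<in> carrier (int_group_ring G)"
    have one: "\<one>\<^bsub>int_group_ring G\<^esub> = (\<lambda>g. if g = \<one> then 1 else 0)"
      by (simp add: int_group_ring_def)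
    show "\<one>\<^bsub>int_group_ring G\<^esub> \<otimes>\<^bsub>int_group_ring G\<^esub> f = f"
    proof
      fix g show "(\<one>\<^bsub>int_group_ring G\<^esub> \<otimes>\<^bsub>int_group_ring G\<^esub> f) g = f g"
      proof (cases "g \<in> carrier G")
        case True
        have "(\<one>\<^bsub>int_group_ring G\<^esub> \<otimes>\<^bsub>int_group_ring G\<^esub> f) g =
            (\<Sum>h \<in> carrier G. if h = \<one> then f (inv h \<otimes> g) else 0)"
          unfolding int_group_ring_mult'[OF fin True] one by (intro sum.cong) auto
        then show ?thesis using True fin by (simp add: sum.delta)
      qed (use f in \<open>simp add: int_group_ring_mult_outside, simp add: int_group_ring_def\<close>)
    qed
    show "f \<otimes>\<^bsub>int_group_ring G\<^esub> \<one>\<^bsub>int_group_ring G\<^esub> = f"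
    proof
      fix g show "(f \<otimes>\<^bsub>int_group_ring G\<^esub> \<one>\<^bsub>int_group_ring G\<^esub>) g = f g"
      proof (cases "g \<in> carrier G")
        case True
        have "inv h \<otimes> g = \<one> \<longleftrightarrow> h = g" if "h \<in> carrier G" for h
          using that True by (metis inv_closed inv_equality inv_inv l_inv)
        then have "(f \<otimes>\<^bsub>int_group_ring G\<^esub> \<one>\<^bsub>int_group_ring G\<^esub>) g =
            (\<Sum>h \<in> carrier G. if h = g then f h else 0)"
          unfolding int_group_ring_mult'[OF fin True] one by (intro sum.cong) auto
        then show ?thesis using True fin by (simp add: sum.delta)
      qed (use f in \<open>simp add: int_group_ring_mult_outside, simp add: int_group_ring_def\<close>)
    qed
  qed (rule int_group_ring_assoc[OF fin])
  fix a b c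
  show "(a \<oplus>\<^bsub>int_group_ring G\<^esub> b) \<otimes>\<^bsub>int_group_ring G\<^esub> c =
      a \<otimes>\<^bsub>int_group_ring G\<^esub> c \<oplus>\<^bsub>int_group_ring G\<^esub> b \<otimes>\<^bsub>int_group_ring G\<^esub> c"
    by (simp add: int_group_ring_def case_prod_beta distrib_right sum.distrib)
  show "c \<otimes>\<^bsub>int_group_ring G\<^esub> (a \<oplus>\<^bsub>int_group_ring G\<^esub> b) =
      c \<otimes>\<^bsub>int_group_ring G\<^esub> a \<oplus>\<^bsub>int_group_ring G\<^esub> c \<otimes>\<^bsub>int_group_ring G\<^esub> b"
    by (simp add: int_group_ring_def case_prod_beta distrib_left sum.distrib)
qed

lemma augmentation_mult:
  assumes fin: "finite (carrier G)"
  shows "augmentation G (f \<otimes>\<^bsub>int_group_ring G\<^esub> f') = augmentation G f * augmentation G f'"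
proof -
  have "augmentation G (f \<otimes>\<^bsub>int_group_ring G\<^esub> f') =
      (\<Sum>g \<in> carrier G. \<Sum>h \<in> carrier G. f h * f' (inv h \<otimes> g))"
    using fin by (simp add: augmentation_def int_group_ring_mult')
  also have "\<dots> = (\<Sum>h \<in> carrier G. \<Sum>g \<in> carrier G. f h * f' (inv h \<otimes> g))"
    by (rule sum.swap)
  also have "\<dots> = (\<Sum>h \<in> carrier G. \<Sum>g \<in> carrier G. f h * f' g)"
  proof (rule sum.cong[OF refl])
    fix h assume h: "h \<in> carrier G"
    show "(\<Sum>g \<in> carrier G. f h * f' (inv h \<otimes> g)) = (\<Sum>g \<in> carrier G. f h * f' g)"
      by (rule sum.reindex_bij_witness[where i = "\<lambda>k. h \<otimes> k" and j = "\<lambda>k. inv h \<otimes> k"])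
        (use h in \<open>auto simp: m_assoc[symmetric]\<close>)
  qed
  finally show ?thesis
    by (simp add: augmentation_def sum_product)
qed

lemma augmentation_one:
  assumes "finite (carrier G)"
  shows "augmentation G \<one>\<^bsub>int_group_ring G\<^esub> = 1"
  using assms by (simp add: augmentation_def int_group_ring_def sum.delta)

lemma group_normalized_units:
  assumes fin: "finite (carrier G)"
  shows "group (normalized_units G)"
proof -
  interpret ZG: ring "int_group_ring G" by (rule ring_int_group_ring[OF fin])
  interpret U: group "units_of (int_group_ring G)" by (rule ZG.units_group)
  have "subgroup {u \<in> Units (int_group_ring G). augmentation G u = 1} (units_of (int_group_ring G))"
  proof (rule U.subgroupI)
    show "{u \<in> Units (int_group_ring G). augmentation G u = 1} \<noteq> {}"
      using augmentation_one[OF fin] ZG.Units_one_closed by blast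
  next
    fix u assume u: "u \<in> {u \<in> Units (int_group_ring G). augmentation G u = 1}"
    then have "augmentation G (inv\<^bsub>int_group_ring G\<^esub> u) = 1"
      using augmentation_mult[OF fin, of u "inv\<^bsub>int_group_ring G\<^esub> u"] augmentation_one[OF fin]
      by simp
    then show "inv\<^bsub>units_of (int_group_ring G)\<^esub> u
        \<in> {u \<in> Units (int_group_ring G). augmentation G u = 1}"
      using u by (simp add: ZG.units_of_inv)
  qed (auto simp: units_of_carrier units_of_mult augmentation_mult[OF fin])
  then show ?thesis
    unfolding normalized_units_def by (rule U.subgroup_imp_group)
qed

end

end

theory Submission
  imports
    Defs
    "HOL-Algebra.Sylow"
    "HOL-Number_Theory.Pocklington"
begin

text \<open>
  Induct on the order of \<open>G\<close> along a nontrivial normal elementary abelian \<open>r\<close>-subgroup \<open>N\<close>. A unit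
  of prime order different from \<open>r\<close> stays nontrivial modulo \<open>N\<close>, and arcs of \<open>G / N\<close> lift to \<open>G\<close>,
  so only two situations need an argument. If \<open>y\<close> acts nontrivially on \<open>x\<close> of order \<open>p = r\<close>, then
  the order \<open>q\<close> of \<open>y\<close> divides \<open>p - 1\<close>, and any element of order \<open>q\<close> of \<open>G\<close> has an eigenvector
  in \<open>N\<close>. If \<open>x\<close> of order \<open>p = r\<close> and \<open>y\<close> of order \<open>q\<close> commute and \<open>x\<close> becomes trivial modulo
  \<open>N\<close>, eigenvalue multiplicities of \<open>x \<otimes> y\<close> on the permutation module of a Sylow \<open>q\<close>-subgroup
  force commuting elements of these orders in \<open>G\<close>.
\<close>

section \<open>Traces of idempotent matrices\<close>

text \<open>A torsion unit need not be conjugate to a group element, so it is accessible mainly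
  through traces of its powers. Averaging these powers against a root of unity gives an idempotent,
  whose trace is a natural number. On the regular module this yields the Berman-Higman theorem
  which, combined with a Frobenius congruence, keeps units of order other than \<open>r\<close>
  nontrivial modulo \<open>N\<close>. For commuting \<open>x\<close> and \<open>y\<close> the
  regular module gives no contradiction, only that \<open>p * q\<close> divides the order of
  \<open>G\<close>. A Sylow \<open>q\<close>-subgroup \<open>Q\<close> removes the factor
  \<open>q\<close>, but its traces involve unknown values at conjugates of nontrivial elements of
  \<open>Q\<close>. If no elements of orders \<open>p\<close> and \<open>q\<close> commute, such
  elements act freely on \<open>N\<close>, so these values enter only through their sums over cosets
  of \<open>N\<close>, where \<open>x \<otimes> y\<close> and \<open>y\<close> agree; they have
  period \<open>q\<close> in the exponent and vanish against a primitive \<open>p\<close>-th root of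
  unity. The exponent \<open>k\<close> in \<open>y \<otimes> x = x [^] k \<otimes> y\<close>
  separates the two situations: it survives in quotients, and if it is not 1 modulo \<open>p\<close>
  it is a primitive \<open>q\<close>-th root of unity there, which makes eigenvectors
  available.\<close>

lemma idempotent_matrix_trace:
  fixes E :: "'b \<Rightarrow> 'b \<Rightarrow> 'k :: field_char_0"
  assumes "finite S"
    and "\<And>a b. a \<in> S \<Longrightarrow> b \<in> S \<Longrightarrow> (\<Sum>c\<in>S. E a c * E c b) = E a b"
  shows "\<exists>k::nat. (\<Sum>a\<in>S. E a a) = of_nat k \<and> (k = 0 \<longrightarrow> (\<forall>a\<in>S. \<forall>b\<in>S. E a b = 0))"
  using assms(2)
\<comment> \<open>The trace of an idempotent is its rank; the number of nonzero rows serves as the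
  measure. The clause for \<open>k = 0\<close> later turns an eigenvalue of multiplicity zero into
  vanishing coefficients.\<close>
proof (induction "card {a \<in> S. \<exists>b\<in>S. E a b \<noteq> 0}" arbitrary: E rule: less_induct)
  case less
  note idem = less.prems
  show ?case
  proof (cases "\<forall>a\<in>S. \<forall>b\<in>S. E a b = 0")
    case True
    then show ?thesis by (intro exI[of _ 0]) auto
  next
    case False
    then obtain s t where st: "s \<in> S" "t \<in> S" "E s t \<noteq> 0" by blast
    \<comment> \<open>subtracting an idempotent of rank one that clears row \<open>s\<close> lowers the trace by one\<close>
    define E' where "E' = (\<lambda>a b. E a b - E a t * E s b / E s t)"
    have idem': "(\<Sum>c\<in>S. E' a c * E' c b) = E' a b" if "a \<in> S" "b \<in> S" for a b
    proof -
      define \<alpha> \<beta> where "\<alpha> = E a t / E s t" and "\<beta> = E s b / E s t"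
      have "(\<Sum>c\<in>S. E' a c * E' c b) =
        (\<Sum>c\<in>S. E a c * E c b - (E a c * E c t) * \<beta> - \<alpha> * (E s c * E c b)
            + \<alpha> * ((E s c * E c t) * \<beta>))"
        by (intro sum.cong) (auto simp: E'_def \<alpha>_def \<beta>_def algebra_simps)
      also have "\<dots> = E a b - E a t * \<beta> - \<alpha> * E s b + \<alpha> * (E s t * \<beta>)"
        by (simp only: sum.distrib sum_subtractf sum_distrib_left[symmetric]
            sum_distrib_right[symmetric] idem[OF that] idem[OF that(1) st(2)] idem[OF st(1) that(2)]
            idem[OF st(1,2)])
      also have "\<dots> = E' a b"
        using st by (simp add: E'_def \<alpha>_def \<beta>_def)
      finally show ?thesis .
    qed
    have "E' s b = 0" for b
      using st by (simp add: E'_def)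
    moreover have "E' a b = 0" if "\<forall>b\<in>S. E a b = 0" "b \<in> S" for a b
      using that st by (simp add: E'_def)
    ultimately have "{a \<in> S. \<exists>b\<in>S. E' a b \<noteq> 0} \<subset> {a \<in> S. \<exists>b\<in>S. E a b \<noteq> 0}"
      using st by blast
    then have "card {a \<in> S. \<exists>b\<in>S. E' a b \<noteq> 0} < card {a \<in> S. \<exists>b\<in>S. E a b \<noteq> 0}"
      using assms(1) by (intro psubset_card_mono) auto
    from less.hyps[OF this idem'] obtain k where k: "(\<Sum>a\<in>S. E' a a) = of_nat k" by blast
    \<comment> \<open>By idempotence the last sum is \<open>E s t\<close>, so the subtracted matrix
      has trace exactly 1.\<close>
    have "(\<Sum>a\<in>S. E' a a) = (\<Sum>a\<in>S. E a a) - (\<Sum>a\<in>S. E s a * E a t) / E s t"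
      by (simp add: E'_def sum_subtractf sum_divide_distrib mult.commute)
    then have "(\<Sum>a\<in>S. E a a) = of_nat (Suc k)"
      using k st unfolding idem[OF st(1,2)] by (simp add: algebra_simps)
    then show ?thesis by blast
  qed
qed

text \<open>Under a map of prime period \<open>r\<close> an orbit has 1 or \<open>r\<close> points,
  and one of the second kind contributes \<open>r\<close> times a value of \<open>f\<close>. The
  induction removes one such orbit \<open>Ob\<close> at a time. It serves for rotations of words and
  for a twisted translation of a normal subgroup.\<close>

lemma sum_cong_sum_fixpoints:
  fixes f :: "'b \<Rightarrow> int"
  assumes "prime r" "finite S"
    and "\<And>x. x \<in> S \<Longrightarrow> \<rho> x \<in> S"
    and "\<And>x. x \<in> S \<Longrightarrow> (\<rho> ^^ r) x = x"
    and "\<And>x. x \<in> S \<Longrightarrow> f (\<rho> x) = f x"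
  shows "int r dvd (\<Sum>x\<in>S. f x) - (\<Sum>x | x \<in> S \<and> \<rho> x = x. f x)"
  using assms(2-5)
proof (induction "card S" arbitrary: S rule: less_induct)
  case less
  note mem = less.prems(2) and per = less.prems(3) and inv = less.prems(4)
  show ?case
  proof (cases "\<forall>x\<in>S. \<rho> x = x")
    case True
    then have "{x \<in> S. \<rho> x = x} = S" by blast
    then show ?thesis by simp
  next
    case False
    then obtain x where x: "x \<in> S" "\<rho> x \<noteq> x" by blast
    have mem': "(\<rho> ^^ i) x \<in> S" for i
      by (induction i) (auto simp: x mem)
    have mult_per: "(\<rho> ^^ (r * i)) y = y" if "y \<in> S" for y i
      using that by (induction i) (auto simp: per funpow_add)
    \<comment> \<open>A repetition before step \<open>r\<close> gives a period \<open>d\<close> with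
      \<open>0 < d < r\<close>. As \<open>d\<close> is prime to \<open>r\<close>, Bezout combines
      both periods to 1, and \<open>x\<close> would be fixed.\<close>
    have inj: "inj_on (\<lambda>i. (\<rho> ^^ i) x) {..<r}"
    proof -
      have False if ij: "i < j" "j < r" "(\<rho> ^^ i) x = (\<rho> ^^ j) x" for i j
      proof -
        define d where "d = j - i"
        have "(\<rho> ^^ (r - i)) ((\<rho> ^^ i) x) = (\<rho> ^^ (r - i)) ((\<rho> ^^ j) x)"
          using ij by simp
        then have "(\<rho> ^^ (r - i + i)) x = (\<rho> ^^ (r - i + j)) x"
          by (simp only: funpow_add o_apply)
        moreover have "r - i + i = r" "r - i + j = d + r"
          using ij by (auto simp: d_def)
        ultimately have "(\<rho> ^^ d) ((\<rho> ^^ r) x) = x"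
          using per[OF x(1)] by (simp add: funpow_add)
        then have d: "(\<rho> ^^ d) x = x" using per[OF x(1)] by simp
        have d': "(\<rho> ^^ (d * n)) x = x" for n
          by (induction n) (auto simp: d funpow_add)
        have "0 < d" "d < r" using ij by (auto simp: d_def)
        then have "\<not> r dvd d" using nat_dvd_not_less by blast
        then have "coprime d r"
          using prime_imp_coprime[OF \<open>prime r\<close>] coprime_commute by blast
        then obtain a b where ab: "d * a = r * b + 1"
          using \<open>0 < d\<close> bezout_nat[of d r] by (auto simp: coprime_iff_gcd_eq_1)
        have swap: "(\<rho> ^^ (r * b)) (\<rho> x) = \<rho> x" using mult_per mem x by blast
        have "x = (\<rho> ^^ (d * a)) x" using d' by simp
        also have "\<dots> = (\<rho> ^^ (r * b)) (\<rho> x)" by (simp only: ab funpow_add) simp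
        also note swap
        finally show False using x by simp
      qed
      then show ?thesis
        unfolding inj_on_def by (metis lessThan_iff linorder_neqE_nat)
    qed
    define Ob where "Ob = (\<lambda>i. (\<rho> ^^ i) x) ` {..<r}"
    have "r > 0" using \<open>prime r\<close> prime_gt_0_nat by blast
    have O_mod: "(\<rho> ^^ i) x \<in> Ob" for i
    proof -
      have "(\<rho> ^^ i) x = (\<rho> ^^ (i mod r + r * (i div r))) x" by simp
      also have "\<dots> = (\<rho> ^^ (i mod r)) ((\<rho> ^^ (r * (i div r))) x)"
        by (simp only: funpow_add o_apply)
      finally have "(\<rho> ^^ i) x = (\<rho> ^^ (i mod r)) ((\<rho> ^^ (r * (i div r))) x)" .
      then have "(\<rho> ^^ i) x = (\<rho> ^^ (i mod r)) x" using mult_per x by simp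
      then show ?thesis using \<open>r > 0\<close> by (auto simp: Ob_def)
    qed
    have O_sub: "Ob \<subseteq> S" by (auto simp: Ob_def mem')
    have fO: "f ((\<rho> ^^ i) x) = f x" for i
      by (induction i) (auto simp: inv mem')
    have sumO: "(\<Sum>y\<in>Ob. f y) = int r * f x"
      unfolding Ob_def by (subst sum.reindex[OF inj]) (simp add: fO)
    have noFix: "\<rho> y \<noteq> y" if "y \<in> Ob" for y
    proof
      assume eq: "\<rho> y = y"
      from that obtain i where i: "i < r" "y = (\<rho> ^^ i) x" by (auto simp: Ob_def)
      have "(\<rho> ^^ n) y = y" for n using eq by (induction n) auto
      then have "y = (\<rho> ^^ (r - i)) ((\<rho> ^^ i) x)" using i by metis
      also have "\<dots> = (\<rho> ^^ r) x" using i by (metis comp_apply funpow_add le_add_diff_inverse2 less_imp_le)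
      finally show False using per x eq by simp
    qed
    have closed: "\<rho> y \<in> S - Ob" if "y \<in> S - Ob" for y
    proof -
      have "y \<in> Ob" if "\<rho> y \<in> Ob"
      proof -
        from that obtain i where i: "\<rho> y = (\<rho> ^^ i) x" by (auto simp: Ob_def)
        have "(\<rho> ^^ Suc (r - 1)) y = y"
          using per[of y] \<open>y \<in> S - Ob\<close> \<open>r > 0\<close> by simp
        then have "y = (\<rho> ^^ (r - 1)) (\<rho> y)"
          by (simp only: funpow_Suc_right o_apply)
        also have "\<dots> = (\<rho> ^^ (r - 1 + i)) x" by (simp add: i funpow_add)
        finally show ?thesis using O_mod by metis
      qed
      then show ?thesis using that mem by auto
    qed
    have "Ob \<noteq> {}" using O_mod by blast
    then have "card (S - Ob) < card S"
      using O_sub less.prems(1) by (intro psubset_card_mono) auto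
    from less.hyps[OF this] have "int r dvd (\<Sum>x\<in>S - Ob. f x) - (\<Sum>x | x \<in> S - Ob \<and> \<rho> x = x. f x)"
      using less.prems(1) closed per inv by simp
    moreover have "{x. x \<in> S - Ob \<and> \<rho> x = x} = {x \<in> S. \<rho> x = x}"
      using noFix by auto
    moreover have "(\<Sum>x\<in>S. f x) = (\<Sum>x\<in>S - Ob. f x) + int r * f x"
      using sum.subset_diff[OF O_sub less.prems(1), of f] sumO by simp
    ultimately show ?thesis
      by (simp add: add_diff_eq[symmetric] add.commute dvd_add)
  qed
qed

lemma sum_powers_eq_0:
  fixes z :: "'k :: field"
  assumes "z ^ n = 1" "z \<noteq> 1"
  shows "(\<Sum>i<n. z ^ i) = 0"
  using assms by (simp add: sum_gp_strict)

lemma sum_periodic_shift: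
  fixes f :: "nat \<Rightarrow> 'k :: ab_group_add"
  assumes "\<And>i. f (i + m) = f i"
  shows "(\<Sum>i<m. f (i + k)) = (\<Sum>i<m. f i)"
proof (induction k)
  case (Suc k)
  have "(\<Sum>i<m. f (i + Suc k)) + f k = (\<Sum>i<Suc m. f (i + k))"
    by (subst sum.lessThan_Suc_shift) (simp add: add.commute)
  also have "\<dots> = (\<Sum>i<m. f (i + k)) + f (k + m)"
    by (simp add: add.commute)
  finally show ?case using Suc assms[of k] by simp
qed simp

section \<open>Eigenvalue multiplicities and the Berman--Higman theorem\<close>

lemma cis_root_power: "m > 0 \<Longrightarrow> cis (2 * pi / real m) ^ m = 1"
  by (simp add: DeMoivre)

lemma cis_root_power_neq_1:
  assumes "0 < l" "l < m"
  shows "cis (2 * pi / real m) ^ l \<noteq> 1"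
proof
  assume "cis (2 * pi / real m) ^ l = 1"
  then have "cis (2 * pi * real l / real m) = cis (2 * pi * real 0 / real m)"
    by (simp add: DeMoivre mult.commute)
  moreover have "inj_on (\<lambda>k. cis (2 * pi * real k / real m)) {..<m}"
    using bij_betw_roots_unity[of m] assms by (simp add: bij_betw_def)
  ultimately show False
    using assms by (auto dest!: inj_onD[where x = l and y = 0])
qed

context group
begin

lemma normalized_units_mult:
  assumes "finite (carrier G)" "g \<in> carrier G"
  shows "(a \<otimes>\<^bsub>normalized_units G\<^esub> b) g = (\<Sum>h\<in>carrier G. a h * b (inv h \<otimes> g))"
  using int_group_ring_mult'[OF assms] by (simp add: normalized_units_def units_of_def)

lemma normalized_units_one:
  "\<one>\<^bsub>normalized_units G\<^esub> = (\<lambda>g. if g = \<one> then 1 else 0)"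
  by (simp add: normalized_units_def units_of_def int_group_ring_def)

lemma normalized_units_outside:
  "u \<in> carrier (normalized_units G) \<Longrightarrow> g \<notin> carrier G \<Longrightarrow> u g = 0"
  by (auto simp: normalized_units_def Units_def int_group_ring_def)

lemma normalized_units_augmentation:
  "u \<in> carrier (normalized_units G) \<Longrightarrow> (\<Sum>g\<in>carrier G. u g) = 1"
  by (auto simp: normalized_units_def augmentation_def)

text \<open>In the matrix product the sum over \<open>c\<close> is a convolution evaluated at
  \<open>a \<otimes> (h \<otimes> k) \<otimes> inv b\<close>. For fixed \<open>h\<close> the product
  \<open>h \<otimes> k\<close> runs over \<open>H\<close>, so every value is met
  \<open>card H\<close> times.\<close>

lemma coset_kernel_mult:
  fixes u v :: "'a \<Rightarrow> int"
  assumes fin: "finite (carrier G)" and H: "subgroup H G"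
    and a: "a \<in> carrier G" and b: "b \<in> carrier G"
  defines "F \<equiv> \<lambda>u a b. \<Sum>h\<in>H. of_int (u (a \<otimes> h \<otimes> inv b)) :: complex"
  shows "(\<Sum>c\<in>carrier G. F u a c * F v c b) = of_nat (card H) * F (u \<otimes>\<^bsub>normalized_units G\<^esub> v) a b"
proof -
  have Hc: "h \<in> carrier G" if "h \<in> H" for h
    using that H by (meson subgroup.mem_carrier)
  define w where "w = u \<otimes>\<^bsub>normalized_units G\<^esub> v"
  have inner: "(\<Sum>c\<in>carrier G. u (a \<otimes> h \<otimes> inv c) * v (c \<otimes> k \<otimes> inv b)) = w (a \<otimes> (h \<otimes> k) \<otimes> inv b)"
    if hk: "h \<in> H" "k \<in> H" for h k
  proof -
    have "(\<Sum>c\<in>carrier G. u (a \<otimes> h \<otimes> inv c) * v (c \<otimes> k \<otimes> inv b))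
        = (\<Sum>g\<in>carrier G. u g * v (inv g \<otimes> (a \<otimes> (h \<otimes> k) \<otimes> inv b)))"
    proof (rule sum.reindex_bij_witness[where i = "\<lambda>g. inv g \<otimes> (a \<otimes> h)" and j = "\<lambda>c. a \<otimes> h \<otimes> inv c"])
      fix c assume c: "c \<in> carrier G"
      show "inv (a \<otimes> h \<otimes> inv c) \<otimes> (a \<otimes> h) = c"
        using a c Hc[OF hk(1)] by (simp add: inv_mult_group m_assoc[symmetric] inv_solve_right)
          (simp add: m_assoc)
      then show "u (a \<otimes> h \<otimes> inv c) * v (inv (a \<otimes> h \<otimes> inv c) \<otimes> (a \<otimes> (h \<otimes> k) \<otimes> inv b))
          = u (a \<otimes> h \<otimes> inv c) * v (c \<otimes> k \<otimes> inv b)"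
        using a b c Hc hk by (metis (no_types, lifting) inv_closed m_assoc m_closed)
    next
      fix g assume g: "g \<in> carrier G"
      show "a \<otimes> h \<otimes> inv (inv g \<otimes> (a \<otimes> h)) = g"
        using a g Hc[OF hk(1)] by (simp add: inv_mult_group m_assoc[symmetric])
          (simp add: m_assoc)
    qed (use a Hc hk in auto)
    also have "\<dots> = w (a \<otimes> (h \<otimes> k) \<otimes> inv b)"
      unfolding w_def using a b Hc hk by (simp add: normalized_units_mult[OF fin])
    finally show ?thesis .
  qed
  have shift: "(\<Sum>k\<in>H. w (a \<otimes> (h \<otimes> k) \<otimes> inv b)) = (\<Sum>k\<in>H. w (a \<otimes> k \<otimes> inv b))" if h: "h \<in> H" for h
    by (rule sum.reindex_bij_witness[where i = "\<lambda>k. inv h \<otimes> k" and j = "\<lambda>k. h \<otimes> k"])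
      (use h H Hc in \<open>auto simp: m_assoc[symmetric] subgroup.m_closed subgroup.m_inv_closed\<close>)
  have "(\<Sum>c\<in>carrier G. F u a c * F v c b) =
      (\<Sum>c\<in>carrier G. \<Sum>h\<in>H. \<Sum>k\<in>H. of_int (u (a \<otimes> h \<otimes> inv c) * v (c \<otimes> k \<otimes> inv b)))"
    by (simp add: F_def sum_product)
  also have "\<dots> = (\<Sum>h\<in>H. \<Sum>c\<in>carrier G. \<Sum>k\<in>H. of_int (u (a \<otimes> h \<otimes> inv c) * v (c \<otimes> k \<otimes> inv b)))"
    by (rule sum.swap)
  also have "\<dots> = (\<Sum>h\<in>H. \<Sum>k\<in>H. \<Sum>c\<in>carrier G. of_int (u (a \<otimes> h \<otimes> inv c) * v (c \<otimes> k \<otimes> inv b)))"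
    by (intro sum.cong refl sum.swap)
  also have "\<dots> = (\<Sum>h\<in>H. of_int (\<Sum>k\<in>H. w (a \<otimes> (h \<otimes> k) \<otimes> inv b)))"
    unfolding of_int_sum by (intro sum.cong refl) (simp only: inner of_int_sum[symmetric])
  also have "\<dots> = (\<Sum>h\<in>H. of_int (\<Sum>k\<in>H. w (a \<otimes> k \<otimes> inv b)))"
    by (simp add: shift)
  finally show ?thesis by (simp add: F_def w_def)
qed

text \<open>
  \<open>F i / card H\<close> is the matrix of \<open>u [^] i\<close> on the permutation module of \<open>G / H\<close>, realised inside
  the functions on \<open>G\<close>; hence \<open>F 0 / card H\<close> is an idempotent and not the identity matrix.
  The sum over \<open>i\<close> is the multiplicity of the eigenvalue \<open>inverse \<theta>\<close>, scaled by \<open>m * card H\<close>.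
\<close>

lemma eigenvalue_multiplicity:
  assumes fin: "finite (carrier G)" and H: "subgroup H G"
    and u: "u \<in> carrier (normalized_units G)"
    and um: "u [^]\<^bsub>normalized_units G\<^esub> m = \<one>\<^bsub>normalized_units G\<^esub>" and m: "m > 0"
    and \<theta>: "\<theta> ^ m = (1 :: complex)"
  defines "F \<equiv> \<lambda>i a b. \<Sum>h\<in>H. of_int ((u [^]\<^bsub>normalized_units G\<^esub> i) (a \<otimes> h \<otimes> inv b)) :: complex"
  shows "\<exists>k::nat. (\<Sum>i<m. \<theta> ^ i * (\<Sum>s\<in>carrier G. F i s s)) = of_nat (k * m * card H) \<and>
    (k = 0 \<longrightarrow> (\<forall>a\<in>carrier G. \<forall>b\<in>carrier G. (\<Sum>i<m. \<theta> ^ i * F i a b) = 0))"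
proof -
  let ?V = "normalized_units G"
  interpret V: group ?V by (rule group_normalized_units[OF fin])
  have "H \<subseteq> carrier G" using H by (rule subgroup.subset)
  then have cH: "card H > 0"
    using fin H by (metis card_gt_0_iff finite_subset subgroup.one_closed empty_iff)
  \<comment> \<open>The factor \<open>m\<close> comes from averaging over the powers of
    \<open>u\<close>, the factor \<open>card H\<close> from \<open>coset_kernel_mult\<close>;
    division by both makes \<open>E\<close> idempotent.\<close>
  define C where "C = (of_nat (m * card H) :: complex)"
  have C: "C \<noteq> 0" using m cH by (simp add: C_def)
  define E where "E = (\<lambda>a b. (\<Sum>i<m. \<theta> ^ i * F i a b) / C)"
  have F_mult: "(\<Sum>c\<in>carrier G. F i a c * F j c b) = of_nat (card H) * F (j + i) a b"
    if "a \<in> carrier G" "b \<in> carrier G" for i j a b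
    unfolding F_def coset_kernel_mult[OF fin H that] V.nat_pow_mult[OF u] by (simp add: add.commute)
  have F_per: "F (i + m) a b = F i a b" for i a b
    using um u by (simp add: F_def flip: V.nat_pow_mult)
  have idem: "(\<Sum>c\<in>carrier G. E a c * E c b) = E a b" if ab: "a \<in> carrier G" "b \<in> carrier G" for a b
  proof -
    have "(\<Sum>c\<in>carrier G. E a c * E c b)
        = (\<Sum>c\<in>carrier G. \<Sum>i<m. \<Sum>j<m. \<theta> ^ (j + i) * (F i a c * F j c b)) / C\<^sup>2"
      unfolding E_def times_divide_times_eq sum_product sum_divide_distrib[symmetric] power2_eq_square
      by (intro arg_cong2[where f = "(/)"] sum.cong refl) (simp add: power_add mult_ac)
    also have "(\<Sum>c\<in>carrier G. \<Sum>i<m. \<Sum>j<m. \<theta> ^ (j + i) * (F i a c * F j c b))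
        = (\<Sum>i<m. \<Sum>c\<in>carrier G. \<Sum>j<m. \<theta> ^ (j + i) * (F i a c * F j c b))"
      by (rule sum.swap)
    also have "\<dots> = (\<Sum>i<m. \<Sum>j<m. \<Sum>c\<in>carrier G. \<theta> ^ (j + i) * (F i a c * F j c b))"
      by (intro sum.cong refl sum.swap)
    also have "\<dots> = (\<Sum>i<m. \<Sum>j<m. of_nat (card H) * (\<theta> ^ (j + i) * F (j + i) a b))"
      by (intro sum.cong refl) (simp add: F_mult[OF ab] flip: sum_distrib_left)
    \<comment> \<open>Powers of \<open>\<theta>\<close> and the matrices \<open>F\<close> both have
      period \<open>m\<close>, so the shift by \<open>i\<close> leaves the sum over \<open>j\<close>
      unchanged.\<close>
    also have "\<dots> = (\<Sum>i<m. \<Sum>j<m. of_nat (card H) * (\<theta> ^ j * F j a b))"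
      by (intro sum.cong refl sum_periodic_shift) (simp add: F_per power_add \<theta>)
    also have "\<dots> = C * (\<Sum>j<m. \<theta> ^ j * F j a b)"
      by (simp add: C_def flip: sum_distrib_left)
    finally show ?thesis
      using C by (simp add: E_def power2_eq_square)
  qed
  from idempotent_matrix_trace[OF fin idem]
  obtain k where k: "(\<Sum>a\<in>carrier G. E a a) = of_nat k"
      "k = 0 \<Longrightarrow> \<forall>a\<in>carrier G. \<forall>b\<in>carrier G. E a b = 0"
    by blast
  have "(\<Sum>i<m. \<theta> ^ i * (\<Sum>s\<in>carrier G. F i s s)) = (\<Sum>i<m. \<Sum>s\<in>carrier G. \<theta> ^ i * F i s s)"
    by (simp add: sum_distrib_left)
  also have "\<dots> = (\<Sum>s\<in>carrier G. \<Sum>i<m. \<theta> ^ i * F i s s)"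
    by (rule sum.swap)
  also have "\<dots> = C * of_nat k"
    using C by (simp add: E_def field_simps flip: k(1) sum_divide_distrib)
  finally show ?thesis
    using k(2) C by (intro exI[of _ k]) (auto simp: E_def C_def)
qed

lemma trivial_coset_trace:
  assumes "finite (carrier G)"
  shows "(\<Sum>s\<in>carrier G. \<Sum>h\<in>{\<one>}. of_int (v (s \<otimes> h \<otimes> inv s)) :: complex) = of_nat (order G) * of_int (v \<one>)"
  using assms by (simp add: order_def)

text \<open>On the regular module the trace of \<open>u\<close> is
  \<open>order G * u \<one>\<close>, a sum of \<open>order G\<close> roots of unity. If the integer
  \<open>u \<one>\<close> is not 0, the triangle inequality becomes an equality, all eigenvalues
  that occur are the same sign, and \<open>u\<close> is that sign times the identity. Augmentation 1
  leaves only the identity.\<close>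

lemma berman_higman:
  fixes m :: nat
  assumes fin: "finite (carrier G)"
    and u: "u \<in> carrier (normalized_units G)"
    and um: "u [^]\<^bsub>normalized_units G\<^esub> m = \<one>\<^bsub>normalized_units G\<^esub>" and m: "m > 0"
    and u1: "u \<noteq> \<one>\<^bsub>normalized_units G\<^esub>"
  shows "u \<one> = 0"
proof (rule ccontr)
  assume nz: "u \<one> \<noteq> 0"
  let ?V = "normalized_units G"
  interpret V: group ?V by (rule group_normalized_units[OF fin])
  have m2: "m \<ge> 2"
    using m um u1 u by (cases "m = 1") (auto simp: V.nat_pow_eone)
  define \<omega> where "\<omega> = cis (2 * pi / real m)"
  have \<omega>m: "(\<omega> ^ l) ^ m = 1" for l
    using cis_root_power[OF m] by (metis \<omega>_def mult.commute power_mult power_one)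
  have orth: "(\<Sum>j<m. (\<omega> ^ l) ^ j) = 0" if "0 < l" "l < m" for l
    using sum_powers_eq_0[OF \<omega>m] cis_root_power_neq_1[OF that] by (simp add: \<omega>_def)
  define n where "n = order G"
  have n: "n > 0" using fin by (simp add: n_def order_gt_0_iff_finite)
  \<comment> \<open>Up to the factor \<open>m\<close>, \<open>c j\<close> is the component of the
    identity in the eigenspace of \<open>u\<close> for the eigenvalue
    \<open>inverse (\<omega> ^ j)\<close>.\<close>
  define c where "c = (\<lambda>j g. \<Sum>i<m. (\<omega> ^ j) ^ i * of_int ((u [^]\<^bsub>?V\<^esub> i) g))"
  have "\<exists>k::nat. of_nat n * c j \<one> = of_nat (k * m) \<and> (k = 0 \<longrightarrow> (\<forall>g\<in>carrier G. c j g = 0))" for j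
  proof -
    obtain k :: nat where k: "(\<Sum>i<m. (\<omega> ^ j) ^ i * (\<Sum>s\<in>carrier G. \<Sum>h\<in>{\<one>}.
          of_int ((u [^]\<^bsub>?V\<^esub> i) (s \<otimes> h \<otimes> inv s)))) = of_nat (k * m * card {\<one>})"
        "k = 0 \<Longrightarrow> \<forall>a\<in>carrier G. \<forall>b\<in>carrier G.
            (\<Sum>i<m. (\<omega> ^ j) ^ i * (\<Sum>h\<in>{\<one>}. of_int ((u [^]\<^bsub>?V\<^esub> i) (a \<otimes> h \<otimes> inv b)))) = 0"
      using eigenvalue_multiplicity[OF fin triv_subgroup u um m \<omega>m] by blast
    have "c j g = 0" if "k = 0" "g \<in> carrier G" for g
      using bspec[OF bspec[OF k(2)[OF that(1)] that(2)] one_closed] that(2) by (simp add: c_def)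
    moreover have "of_nat n * c j \<one> = of_nat (k * m)"
      using k(1) unfolding trivial_coset_trace[OF fin]
      by (simp add: c_def n_def sum_distrib_left mult_ac)
    ultimately show ?thesis by blast
  qed
  then obtain k :: "nat \<Rightarrow> nat" where k: "\<And>j. of_nat n * c j \<one> = of_nat (k j * m)"
      "\<And>j g. k j = 0 \<Longrightarrow> g \<in> carrier G \<Longrightarrow> c j g = 0"
    by metis
  have swap: "(\<Sum>j<m. (\<omega> ^ j) ^ l * c j g)
      = (\<Sum>i<m. of_int ((u [^]\<^bsub>?V\<^esub> i) g) * (\<Sum>j<m. (\<omega> ^ (l + i)) ^ j))" for l g
  proof -
    have "(\<Sum>j<m. (\<omega> ^ j) ^ l * c j g)
        = (\<Sum>j<m. \<Sum>i<m. of_int ((u [^]\<^bsub>?V\<^esub> i) g) * (\<omega> ^ (l + i)) ^ j)"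
      unfolding c_def sum_distrib_left
      by (intro sum.cong refl) (simp add: mult_ac add_ac distrib_left flip: power_mult power_add)
    also have "\<dots> = (\<Sum>i<m. \<Sum>j<m. of_int ((u [^]\<^bsub>?V\<^esub> i) g) * (\<omega> ^ (l + i)) ^ j)"
      by (rule sum.swap)
    finally show ?thesis by (simp add: sum_distrib_left)
  qed
  have inv0: "(\<Sum>j<m. c j g) = of_nat m * of_int (\<one>\<^bsub>?V\<^esub> g)" for g
  proof -
    have "(\<Sum>j<m. c j g) = (\<Sum>i<m. of_int ((u [^]\<^bsub>?V\<^esub> i) g) * (\<Sum>j<m. (\<omega> ^ i) ^ j))"
      using swap[of 0 g] by simp
    also have "\<dots> = (\<Sum>i<m. if i = 0 then of_nat m * of_int (\<one>\<^bsub>?V\<^esub> g) else 0)"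
      by (intro sum.cong refl) (auto simp: orth)
    finally show ?thesis using m by simp
  qed
  \<comment> \<open>The exponent \<open>m - 1\<close> stands for -1: Fourier inversion recovers
    \<open>u\<close> as the sum of its eigenvalues times the components.\<close>
  have inv1: "(\<Sum>j<m. (\<omega> ^ j) ^ (m - 1) * c j g) = of_nat m * of_int (u g)" for g
  proof -
    have "(\<Sum>j<m. (\<omega> ^ (m - 1 + i)) ^ j) = (if i = 1 then of_nat m else 0)" if "i < m" for i
    proof -
      consider "i = 0" | "i = 1" | "i \<ge> 2" by linarith
      then show ?thesis
      proof cases
        case 1 then show ?thesis using orth[of "m - 1"] m2 by simp
      next
        case 2 then show ?thesis using \<omega>m[of 1] m by simp
      next
        case 3
        then have "m - 1 + i = m + (i - 1)" using m by simp
        then have "\<omega> ^ (m - 1 + i) = \<omega> ^ (i - 1)" using \<omega>m[of 1] by (simp only: power_add) simp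
        then show ?thesis using orth[of "i - 1"] 3 that by simp
      qed
    qed
    then have "(\<Sum>j<m. (\<omega> ^ j) ^ (m - 1) * c j g)
        = (\<Sum>i<m. if i = 1 then of_nat m * of_int (u g) else 0)"
      unfolding swap using u by (intro sum.cong refl) auto
    then show ?thesis using m2 by simp
  qed
  define z where "z = (\<lambda>j. (\<omega> ^ j) ^ (m - 1))"
  have inv_z: "(\<Sum>j<m. z j * c j g) = of_nat m * of_int (u g)" for g
    by (simp only: z_def inv1)
  have norm_z: "norm (z j) = 1" for j
    by (simp add: z_def \<omega>_def norm_power)
  define \<sigma> where "\<sigma> = sgn (real_of_int (u \<one>))"
  have \<sigma>: "\<sigma> = 1 \<or> \<sigma> = -1" "\<sigma> * real_of_int (u \<one>) = \<bar>real_of_int (u \<one>)\<bar>"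
    using nz by (auto simp: \<sigma>_def sgn_if)
  have ck: "of_nat (k j) = of_nat n * c j \<one> / (of_nat m :: complex)" for j
    using k(1)[of j] m by (simp add: field_simps)
  have "(\<Sum>j<m. of_nat (k j) :: complex) = of_nat n * (\<Sum>j<m. c j \<one>) / of_nat m"
    by (simp add: ck sum_distrib_left sum_divide_distrib)
  then have sum_k: "(\<Sum>j<m. of_nat (k j) :: complex) = of_nat n"
    using m by (simp add: inv0 normalized_units_one)
  have "(\<Sum>j<m. z j * of_nat (k j)) = of_nat n * (\<Sum>j<m. z j * c j \<one>) / of_nat m"
    unfolding ck by (simp add: sum_distrib_left sum_divide_distrib mult_ac)
  then have sum_zk: "(\<Sum>j<m. z j * of_nat (k j)) = of_nat n * of_int (u \<one>)"
    using m by (simp add: inv_z)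
  \<comment> \<open>Each summand is nonnegative because \<open>z j\<close> lies on the unit circle,
    while the total is at most 0; so every \<open>z j\<close> of nonzero multiplicity equals
    \<open>\<sigma>\<close>.\<close>
  have "(\<Sum>j<m. real (k j) * (1 - \<sigma> * Re (z j)))
      = Re (\<Sum>j<m. of_nat (k j)) - \<sigma> * Re (\<Sum>j<m. z j * of_nat (k j))"
    by (simp add: sum_subtractf sum_distrib_left algebra_simps)
  also have "\<dots> = real n - real n * \<bar>real_of_int (u \<one>)\<bar>"
    unfolding sum_k sum_zk \<sigma>(2)[symmetric] by simp
  also have "\<dots> \<le> 0"
  proof -
    have "\<bar>real_of_int (u \<one>)\<bar> \<ge> 1" using nz by linarith
    then have "real n * 1 \<le> real n * \<bar>real_of_int (u \<one>)\<bar>" by (intro mult_left_mono) auto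
    then show ?thesis by simp
  qed
  finally have le0: "(\<Sum>j<m. real (k j) * (1 - \<sigma> * Re (z j))) \<le> 0" .
  have Re_le: "\<sigma> * Re (z j) \<le> 1" for j
    using \<sigma>(1) abs_Re_le_cmod[of "z j"] norm_z[of j] by auto
  have eq0: "real (k j) * (1 - \<sigma> * Re (z j)) = 0" if "j < m" for j
  proof (rule sum_nonneg_0[where s = "{..<m}"])
    show "(\<Sum>j<m. real (k j) * (1 - \<sigma> * Re (z j))) = 0"
      using le0 Re_le by (intro antisym sum_nonneg) auto
  qed (use that Re_le in auto)
  have zc: "z j * c j g = of_real \<sigma> * c j g" if "j < m" "g \<in> carrier G" for j g
  proof (cases "k j = 0")
    case True
    then show ?thesis using k(2) that by simp
  next
    case False
    then have "\<sigma> * Re (z j) = 1" using eq0[OF that(1)] by simp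
    then have "Re (z j) = \<sigma>" using \<sigma>(1) by auto
    moreover from this have "Im (z j) = 0"
      using norm_z[of j] \<sigma>(1) cmod_power2[of "z j"] by auto
    ultimately show ?thesis by (simp add: complex_eq_iff)
  qed
  have ug: "of_int (u g) = complex_of_real \<sigma> * of_int (\<one>\<^bsub>?V\<^esub> g)" if g: "g \<in> carrier G" for g
  proof -
    have "of_nat m * of_int (u g) = (\<Sum>j<m. z j * c j g)" by (simp add: inv_z)
    also have "\<dots> = of_real \<sigma> * (\<Sum>j<m. c j g)" by (simp add: zc g sum_distrib_left)
    finally show ?thesis using m by (simp add: inv0)
  qed
  obtain s :: int where s: "\<sigma> = real_of_int s" using \<sigma>(1) by (metis of_int_1 of_int_minus)
  have us: "u g = s * \<one>\<^bsub>?V\<^esub> g" if "g \<in> carrier G" for g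
  proof -
    have "complex_of_int (u g) = complex_of_int (s * \<one>\<^bsub>?V\<^esub> g)"
      using ug[OF that] by (simp add: s)
    then show ?thesis by (simp only: of_int_eq_iff)
  qed
  have "1 = (\<Sum>g\<in>carrier G. u g)"
    using normalized_units_augmentation[OF u] by simp
  also have "\<dots> = s * (\<Sum>g\<in>carrier G. \<one>\<^bsub>?V\<^esub> g)"
    by (simp add: us sum_distrib_left)
  finally have "s = 1" by (simp add: normalized_units_augmentation)
  then have "u g = \<one>\<^bsub>?V\<^esub> g" for g
    using us normalized_units_outside[OF u] normalized_units_outside[OF V.one_closed]
    by (cases "g \<in> carrier G") auto
  then show False using u1 by blast
qed

text \<open>By \<open>berman_higman\<close> only the zeroth of the first \<open>q\<close> powers has
  nonzero trace on the regular module, so the eigenvalue 1 of \<open>u\<close> has multiplicity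
  \<open>order G / q\<close>, which is therefore an integer.\<close>

lemma unit_prime_order_dvd:
  assumes fin: "finite (carrier G)"
    and u: "u \<in> carrier (normalized_units G)"
    and um: "u [^]\<^bsub>normalized_units G\<^esub> q = \<one>\<^bsub>normalized_units G\<^esub>" and q: "prime q"
    and u1: "u \<noteq> \<one>\<^bsub>normalized_units G\<^esub>"
  shows "q dvd order G"
proof -
  let ?V = "normalized_units G"
  interpret V: group ?V by (rule group_normalized_units[OF fin])
  have q0: "q > 0" using q prime_gt_0_nat by blast
  have "V.ord u dvd q" using u um by (simp add: V.pow_eq_id)
  then have ord: "V.ord u = q"
    using u u1 q V.ord_eq_1 by (auto simp: prime_nat_iff)
  have pow: "(u [^]\<^bsub>?V\<^esub> i) \<one> = (if i = 0 then 1 else 0)" if "i < q" for i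
  proof (cases "i = 0")
    case False
    then have "u [^]\<^bsub>?V\<^esub> i \<noteq> \<one>\<^bsub>?V\<^esub>"
      using that u ord by (simp add: V.pow_eq_id nat_dvd_not_less)
    moreover have "(u [^]\<^bsub>?V\<^esub> i) [^]\<^bsub>?V\<^esub> q = \<one>\<^bsub>?V\<^esub>"
      using u um by (metis V.nat_pow_one V.nat_pow_pow mult.commute)
    ultimately show ?thesis
      using berman_higman[OF fin, of "u [^]\<^bsub>?V\<^esub> i" q] False q0 u by simp
  qed (simp add: normalized_units_one)
  obtain k :: nat where k: "(\<Sum>i<q. 1 ^ i * (\<Sum>s\<in>carrier G. \<Sum>h\<in>{\<one>}.
          of_int ((u [^]\<^bsub>?V\<^esub> i) (s \<otimes> h \<otimes> inv s)))) = (of_nat (k * q * card {\<one>}) :: complex)"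
    using eigenvalue_multiplicity[OF fin triv_subgroup u um q0, of 1] by auto
  have "of_nat (k * q) = (\<Sum>i<q. of_nat (order G) * of_int ((u [^]\<^bsub>?V\<^esub> i) \<one>) :: complex)"
    using k unfolding trivial_coset_trace[OF fin] by simp
  also have "\<dots> = (\<Sum>i<q. if i = 0 then of_nat (order G) else 0)"
    by (intro sum.cong refl) (simp add: pow)
  also have "\<dots> = of_nat (order G)" using q0 by simp
  finally have "k * q = order G" by (simp only: of_nat_eq_iff)
  then show ?thesis by (metis dvd_triv_right)
qed

end

section \<open>Frobenius congruences and reduction modulo a normal subgroup\<close>

lemma int_fermat:
  assumes "prime r"
  shows "[a ^ r = a] (mod int r)"
proof (cases "int r dvd a")
  case True
  then show ?thesis
    using prime_gt_0_nat[OF assms] by (simp add: cong_def mod_0_imp_dvd zero_power dvd_power_le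
        dvd_imp_mod_0 dvd_power dvd_trans[OF True])
next
  case False
  define n where "n = nat (a mod int r)"
  have r: "r > 0" using assms prime_gt_0_nat by blast
  have n: "[a = int n] (mod int r)" using r by (simp add: n_def cong_def)
  have "\<not> r dvd n"
    using False n cong_dvd_iff by (metis cong_sym_eq int_dvd_int_iff cong_dvd_modulus cong_def mod_0_imp_dvd dvd_imp_mod_0)
  then have "[n ^ (r - 1) = 1] (mod r)" using fermat_theorem[OF assms] by blast
  then have "[n ^ (r - 1) * n = 1 * n] (mod r)" by (intro cong_mult) auto
  then have "[n ^ r = n] (mod r)" using r by (metis mult_1 power_minus_mult)
  then have "[int n ^ r = int n] (mod int r)" by (metis cong_int_iff of_nat_power)
  then show ?thesis using n by (meson cong_pow cong_sym cong_trans)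
qed

lemma rotate1_fixpoint:
  assumes "rotate1 xs = xs" "xs \<noteq> []"
  shows "xs = replicate (length xs) (hd xs)"
proof (rule replicate_eqI[OF refl])
  fix y assume "y \<in> set xs"
  then obtain i where i: "i < length xs" "y = xs ! i" by (auto simp: in_set_conv_nth)
  have "rotate n xs = xs" for n by (induction n) (auto simp: assms)
  then have "hd xs = hd (rotate i xs)" by simp
  then show "y = hd xs" using i assms(2) by (simp add: hd_rotate_conv_nth)
qed

text \<open>The map of integral group rings induced by \<open>\<phi>\<close>, on coefficient
  functions.\<close>

definition pushforward :: "('a, 'b) monoid_scheme \<Rightarrow> ('a \<Rightarrow> 'c) \<Rightarrow> ('a \<Rightarrow> int) \<Rightarrow> 'c \<Rightarrow> int" where
  "pushforward G \<phi> u = (\<lambda>c. \<Sum>g | g \<in> carrier G \<and> \<phi> g = c. u g)"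

context group
begin

lemma normalized_unitsI:
  assumes "\<And>g. g \<notin> carrier G \<Longrightarrow> u g = 0" "\<And>g. g \<notin> carrier G \<Longrightarrow> v g = 0"
    and "u \<otimes>\<^bsub>normalized_units G\<^esub> v = \<one>\<^bsub>normalized_units G\<^esub>"
    and "v \<otimes>\<^bsub>normalized_units G\<^esub> u = \<one>\<^bsub>normalized_units G\<^esub>"
    and "(\<Sum>g\<in>carrier G. u g) = 1"
  shows "u \<in> carrier (normalized_units G)"
proof -
  have "u \<in> carrier (int_group_ring G)" "v \<in> carrier (int_group_ring G)"
    using assms(1,2) by (auto simp: int_group_ring_def)
  moreover have "u \<otimes>\<^bsub>int_group_ring G\<^esub> v = \<one>\<^bsub>int_group_ring G\<^esub>"
      "v \<otimes>\<^bsub>int_group_ring G\<^esub> u = \<one>\<^bsub>int_group_ring G\<^esub>"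
    using assms(3,4) by (simp_all add: normalized_units_def units_of_def)
  ultimately show ?thesis
    using assms(5) by (auto simp: normalized_units_def augmentation_def Units_def)
qed

lemma normalized_units_mult_outside:
  "g \<notin> carrier G \<Longrightarrow> (a \<otimes>\<^bsub>normalized_units G\<^esub> b) g = 0"
  using int_group_ring_mult_outside by (simp add: normalized_units_def units_of_def)

definition words :: "nat \<Rightarrow> 'a set \<Rightarrow> 'a list set" where
  "words n C = {xs. set xs \<subseteq> carrier G \<and> length xs = n \<and> foldr (\<otimes>) xs \<one> \<in> C}"

lemma foldr_mult_closed: "set xs \<subseteq> carrier G \<Longrightarrow> foldr (\<otimes>) xs \<one> \<in> carrier G"
  by (induction xs) auto

lemma foldr_mult_snoc:
  "set xs \<subseteq> carrier G \<Longrightarrow> x \<in> carrier G \<Longrightarrow> foldr (\<otimes>) (xs @ [x]) \<one> = foldr (\<otimes>) xs \<one> \<otimes> x"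
  by (induction xs) (auto simp: m_assoc foldr_mult_closed simp del: foldr_append)

lemma foldr_mult_replicate:
  "x \<in> carrier G \<Longrightarrow> foldr (\<otimes>) (replicate n x) \<one> = x [^] n"
  by (induction n) (simp_all flip: nat_pow_Suc2)

lemma finite_words: "finite (carrier G) \<Longrightarrow> finite (words n C)"
  by (rule finite_subset[OF _ finite_lists_length_eq[of "carrier G" n]]) (auto simp: words_def)

lemma nat_pow_eq_sum_words:
  assumes fin: "finite (carrier G)" and u: "u \<in> carrier (normalized_units G)"
    and g: "g \<in> carrier G"
  shows "(u [^]\<^bsub>normalized_units G\<^esub> n) g = (\<Sum>xs\<in>words n {g}. prod_list (map u xs))"
  using g
proof (induction n arbitrary: g)
  case 0
  have "words 0 {g} = (if g = \<one> then {[]} else {})" by (auto simp: words_def)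
  then show ?case by (simp add: normalized_units_one)
next
  case (Suc n)
  interpret V: group "normalized_units G" by (rule group_normalized_units[OF fin])
  have "(u [^]\<^bsub>normalized_units G\<^esub> Suc n) g
      = (\<Sum>h\<in>carrier G. u h * (u [^]\<^bsub>normalized_units G\<^esub> n) (inv h \<otimes> g))"
    using Suc.prems u by (simp only: V.nat_pow_Suc2 normalized_units_mult[OF fin])
  also have "\<dots> = (\<Sum>h\<in>carrier G. \<Sum>xs\<in>words n {inv h \<otimes> g}. u h * prod_list (map u xs))"
    using Suc by (simp add: sum_distrib_left)
  also have "\<dots> = (\<Sum>(h, xs)\<in>(SIGMA h:carrier G. words n {inv h \<otimes> g}). u h * prod_list (map u xs))"
    using fin finite_words by (intro sum.Sigma) auto
  also have "\<dots> = (\<Sum>xs\<in>words (Suc n) {g}. prod_list (map u xs))"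
  proof (rule sum.reindex_bij_witness[where i = "\<lambda>ys. (hd ys, tl ys)" and j = "\<lambda>(h, xs). h # xs"])
    fix ys assume "ys \<in> words (Suc n) {g}"
    then obtain y zs where ys: "ys = y # zs" "y \<in> carrier G" "set zs \<subseteq> carrier G"
        "length zs = n" "y \<otimes> foldr (\<otimes>) zs \<one> = g"
      by (cases ys) (auto simp: words_def)
    moreover have "foldr (\<otimes>) zs \<one> = inv y \<otimes> g"
      using ys foldr_mult_closed[OF ys(3)] by (auto simp: m_assoc[symmetric])
    ultimately show "(hd ys, tl ys) \<in> (SIGMA h:carrier G. words n {inv h \<otimes> g})"
        "(case (hd ys, tl ys) of (h, xs) \<Rightarrow> h # xs) = ys"
      by (auto simp: words_def)
  next
    fix a assume "a \<in> (SIGMA h:carrier G. words n {inv h \<otimes> g})"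
    then show "(case a of (h, xs) \<Rightarrow> h # xs) \<in> words (Suc n) {g}"
      using Suc.prems by (auto simp: words_def m_assoc[symmetric])
  qed (auto simp: words_def)
  finally show ?case .
qed

lemma sum_nat_pow_eq_sum_words:
  assumes fin: "finite (carrier G)" and u: "u \<in> carrier (normalized_units G)"
    and C: "C \<subseteq> carrier G"
  shows "(\<Sum>g\<in>C. (u [^]\<^bsub>normalized_units G\<^esub> n) g) = (\<Sum>xs\<in>words n C. prod_list (map u xs))"
proof -
  have "(\<Sum>g\<in>C. (u [^]\<^bsub>normalized_units G\<^esub> n) g)
      = (\<Sum>g\<in>C. \<Sum>xs | xs \<in> words n C \<and> foldr (\<otimes>) xs \<one> = g. prod_list (map u xs))"
  proof (intro sum.cong refl)
    fix g assume "g \<in> C"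
    then have "words n {g} = {xs \<in> words n C. foldr (\<otimes>) xs \<one> = g}" by (auto simp: words_def)
    then show "(u [^]\<^bsub>normalized_units G\<^esub> n) g
        = (\<Sum>xs | xs \<in> words n C \<and> foldr (\<otimes>) xs \<one> = g. prod_list (map u xs))"
      using nat_pow_eq_sum_words[OF fin u] \<open>g \<in> C\<close> C by auto
  qed
  also have "\<dots> = (\<Sum>xs\<in>words n C. prod_list (map u xs))"
    using finite_words[OF fin] finite_subset[OF C fin]
    by (intro sum.group) (auto simp: words_def)
  finally show ?thesis .
qed

text \<open>
  Cyclic rotation acts on the words of length \<open>r\<close> with product in a conjugation-invariant set;
  modulo \<open>r\<close> only the constant words survive.
\<close>

lemma frobenius_cong:
  assumes fin: "finite (carrier G)" and u: "u \<in> carrier (normalized_units G)"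
    and C: "C \<subseteq> carrier G" and conj: "\<And>c x. c \<in> C \<Longrightarrow> x \<in> carrier G \<Longrightarrow> inv x \<otimes> c \<otimes> x \<in> C"
    and r: "prime r"
  shows "[(\<Sum>g\<in>C. (u [^]\<^bsub>normalized_units G\<^esub> r) g)
      = (\<Sum>g | g \<in> carrier G \<and> g [^] r \<in> C. u g)] (mod int r)"
proof -
  have r0: "r > 0" using r prime_gt_0_nat by blast
  define f where "f = (\<lambda>xs. prod_list (map u xs))"
  have rot: "rotate1 xs \<in> words r C" if "xs \<in> words r C" for xs
  proof (cases xs)
    case (Cons y ys)
    then have y: "y \<in> carrier G" "set ys \<subseteq> carrier G" "y \<otimes> foldr (\<otimes>) ys \<one> \<in> C"
      using that by (auto simp: words_def)
    \<comment> \<open>Moving the first letter to the end conjugates the product by that letter,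
      hence the closure of \<open>C\<close> under conjugation.\<close>
    then have "foldr (\<otimes>) ys \<one> \<otimes> y = inv y \<otimes> (y \<otimes> foldr (\<otimes>) ys \<one>) \<otimes> y"
      using foldr_mult_closed by (simp add: m_assoc[symmetric])
    then have "foldr (\<otimes>) (ys @ [y]) \<one> \<in> C"
      using conj y by (simp only: foldr_mult_snoc)
    then show ?thesis using that Cons by (simp add: words_def del: foldr_append)
  qed (use that in simp)
  have "int r dvd (\<Sum>xs\<in>words r C. f xs) - (\<Sum>xs | xs \<in> words r C \<and> rotate1 xs = xs. f xs)"
  proof (rule sum_cong_sum_fixpoints[OF r finite_words[OF fin] rot])
    fix xs assume "xs \<in> words r C"
    then have "rotate r xs = xs" by (simp add: words_def rotate_id)
    then show "(rotate1 ^^ r) xs = xs" by (simp add: rotate_def)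
    show "f (rotate1 xs) = f xs"
      by (cases xs) (simp_all add: f_def mult.commute)
  qed
  then have "[(\<Sum>xs\<in>words r C. f xs) = (\<Sum>xs | xs \<in> words r C \<and> rotate1 xs = xs. f xs)] (mod int r)"
    by (simp add: cong_iff_dvd_diff)
  moreover have "(\<Sum>xs | xs \<in> words r C \<and> rotate1 xs = xs. f xs)
      = (\<Sum>g | g \<in> carrier G \<and> g [^] r \<in> C. u g ^ r)"
  proof (rule sum.reindex_bij_witness[where i = "replicate r" and j = hd])
    fix xs assume xs: "xs \<in> {xs \<in> words r C. rotate1 xs = xs}"
    then have ne: "xs \<noteq> []" using r0 by (auto simp: words_def)
    then obtain x where eq: "xs = replicate r x"
      using rotate1_fixpoint[of xs] xs by (auto simp: words_def)
    then have x: "x \<in> carrier G" "hd xs = x" using xs r0 by (auto simp: words_def)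
    then show "replicate r (hd xs) = xs" "hd xs \<in> {g \<in> carrier G. g [^] r \<in> C}"
        "u (hd xs) ^ r = f xs"
      using xs by (auto simp: eq words_def foldr_mult_replicate f_def simp del: foldr_replicate)
  next
    fix g assume "g \<in> {g \<in> carrier G. g [^] r \<in> C}"
    then show "replicate r g \<in> {xs \<in> words r C. rotate1 xs = xs}" "hd (replicate r g) = g"
      using r0 by (auto simp: words_def foldr_mult_replicate simp del: foldr_replicate)
  qed
  \<comment> \<open>A constant word contributes \<open>u g ^ r\<close>; Fermat's little theorem
    removes the exponent modulo \<open>r\<close>.\<close>
  moreover have "[(\<Sum>g | g \<in> carrier G \<and> g [^] r \<in> C. u g ^ r)
      = (\<Sum>g | g \<in> carrier G \<and> g [^] r \<in> C. u g)] (mod int r)"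
    by (intro cong_sum int_fermat r)
  ultimately have "[(\<Sum>xs\<in>words r C. f xs)
      = (\<Sum>g | g \<in> carrier G \<and> g [^] r \<in> C. u g)] (mod int r)"
    by (simp add: cong_def)
  then show ?thesis
    by (simp add: sum_nat_pow_eq_sum_words[OF fin u C] f_def)
qed

text \<open>The set \<open>C'\<close> of \<open>r\<close>-th roots of elements of \<open>C\<close>
  is again closed under conjugation, so \<open>frobenius_cong\<close> applies to it in turn; each
  round trades a factor \<open>r\<close> in the exponent of the unit for an \<open>r\<close>-th root
  in \<open>G\<close>.\<close>

lemma iterated_frobenius_cong:
  assumes fin: "finite (carrier G)" and u: "u \<in> carrier (normalized_units G)" and r: "prime r"
    and C: "C \<subseteq> carrier G" "\<And>c x. c \<in> C \<Longrightarrow> x \<in> carrier G \<Longrightarrow> inv x \<otimes> c \<otimes> x \<in> C"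
  shows "[(\<Sum>g\<in>C. (u [^]\<^bsub>normalized_units G\<^esub> (r ^ n)) g)
      = (\<Sum>g | g \<in> carrier G \<and> g [^] (r ^ n) \<in> C. u g)] (mod int r)"
  using C
proof (induction n arbitrary: C)
  case 0
  interpret V: group "normalized_units G" by (rule group_normalized_units[OF fin])
  have "{g \<in> carrier G. g [^] (r ^ 0) \<in> C} = C" using 0 by auto
  then show ?case using u by simp
next
  case (Suc n)
  let ?V = "normalized_units G"
  interpret V: group ?V by (rule group_normalized_units[OF fin])
  define C' where "C' = {g \<in> carrier G. g [^] r \<in> C}"
  have pow_conj: "(inv x \<otimes> c \<otimes> x) [^] k = inv x \<otimes> c [^] k \<otimes> x"
    if "c \<in> carrier G" "x \<in> carrier G" for c x and k :: nat
    using that by (induction k) (simp_all add: m_assoc inv_solve_left' flip: m_assoc[of x "inv x"])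
  have conj': "inv x \<otimes> c \<otimes> x \<in> C'" if "c \<in> C'" "x \<in> carrier G" for c x
    using that Suc.prems by (auto simp: C'_def pow_conj)
  have step: "[(\<Sum>g\<in>C. ((u [^]\<^bsub>?V\<^esub> (r ^ n)) [^]\<^bsub>?V\<^esub> r) g) = (\<Sum>g\<in>C'. (u [^]\<^bsub>?V\<^esub> (r ^ n)) g)] (mod int r)"
    unfolding C'_def using Suc.prems u by (intro frobenius_cong fin r) auto
  have IH: "[(\<Sum>g\<in>C'. (u [^]\<^bsub>?V\<^esub> (r ^ n)) g)
      = (\<Sum>g | g \<in> carrier G \<and> g [^] (r ^ n) \<in> C'. u g)] (mod int r)"
    using conj' by (intro Suc.IH) (auto simp: C'_def)
  have pow: "(u [^]\<^bsub>?V\<^esub> (r ^ n)) [^]\<^bsub>?V\<^esub> r = u [^]\<^bsub>?V\<^esub> (r ^ Suc n)"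
    using u by (simp add: V.nat_pow_pow mult.commute)
  have set: "{g \<in> carrier G. g [^] (r ^ n) \<in> C'} = {g \<in> carrier G. g [^] (r ^ Suc n) \<in> C}"
    by (auto simp: C'_def nat_pow_pow mult.commute)
  show ?case using cong_trans[OF step IH] unfolding pow set .
qed

end

section \<open>Functoriality of normalized units, and units with trivial image\<close>

context group_hom
begin

lemma pushforward_outside: "c \<notin> carrier H \<Longrightarrow> pushforward G h u c = 0"
  by (auto simp: pushforward_def intro!: sum.neutral)

lemma pushforward_mult:
  assumes fin: "finite (carrier G)" "finite (carrier H)"
  shows "pushforward G h (a \<otimes>\<^bsub>normalized_units G\<^esub> b)
    = pushforward G h a \<otimes>\<^bsub>normalized_units H\<^esub> pushforward G h b"
proof
  fix c
  show "pushforward G h (a \<otimes>\<^bsub>normalized_units G\<^esub> b) c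
    = (pushforward G h a \<otimes>\<^bsub>normalized_units H\<^esub> pushforward G h b) c"
  proof (cases "c \<in> carrier H")
    case False
    then show ?thesis
      using H.normalized_units_mult_outside[OF False] by (simp add: pushforward_outside)
  next
    case c: True
    have "(pushforward G h a \<otimes>\<^bsub>normalized_units H\<^esub> pushforward G h b) c
        = (\<Sum>d\<in>carrier H. \<Sum>x | x \<in> carrier G \<and> h x = d. a x * pushforward G h b (inv\<^bsub>H\<^esub> d \<otimes>\<^bsub>H\<^esub> c))"
      by (simp add: H.normalized_units_mult[OF fin(2) c] pushforward_def sum_distrib_right)
    also have "\<dots> = (\<Sum>d\<in>carrier H. \<Sum>x | x \<in> carrier G \<and> h x = d.
        a x * pushforward G h b (inv\<^bsub>H\<^esub> h x \<otimes>\<^bsub>H\<^esub> c))"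
      by (intro sum.cong) auto
    also have "\<dots> = (\<Sum>x\<in>carrier G. a x * pushforward G h b (inv\<^bsub>H\<^esub> h x \<otimes>\<^bsub>H\<^esub> c))"
      using fin by (intro sum.group) auto
    also have "\<dots> = (\<Sum>x\<in>carrier G. \<Sum>g | g \<in> carrier G \<and> h g = c. a x * b (inv x \<otimes> g))"
    proof (intro sum.cong refl)
      fix x assume x: "x \<in> carrier G"
      have "(\<Sum>g | g \<in> carrier G \<and> h g = c. b (inv x \<otimes> g)) = pushforward G h b (inv\<^bsub>H\<^esub> h x \<otimes>\<^bsub>H\<^esub> c)"
        unfolding pushforward_def
        by (rule sum.reindex_bij_witness[where i = "\<lambda>k. x \<otimes> k" and j = "\<lambda>g. inv x \<otimes> g"])
          (use x c in \<open>auto simp: G.m_assoc[symmetric] H.m_assoc[symmetric]\<close>)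
      then show "a x * pushforward G h b (inv\<^bsub>H\<^esub> h x \<otimes>\<^bsub>H\<^esub> c)
          = (\<Sum>g | g \<in> carrier G \<and> h g = c. a x * b (inv x \<otimes> g))"
        by (simp flip: sum_distrib_left)
    qed
    also have "\<dots> = (\<Sum>g | g \<in> carrier G \<and> h g = c. \<Sum>x\<in>carrier G. a x * b (inv x \<otimes> g))"
      by (rule sum.swap)
    also have "\<dots> = pushforward G h (a \<otimes>\<^bsub>normalized_units G\<^esub> b) c"
      unfolding pushforward_def by (intro sum.cong) (auto simp: G.normalized_units_mult[OF fin(1)])
    finally show ?thesis by simp
  qed
qed

lemma pushforward_one:
  assumes fin: "finite (carrier G)"
  shows "pushforward G h \<one>\<^bsub>normalized_units G\<^esub> = \<one>\<^bsub>normalized_units H\<^esub>"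
proof
  fix c
  have "pushforward G h \<one>\<^bsub>normalized_units G\<^esub> c
      = (\<Sum>g | g \<in> carrier G \<and> h g = c. if g = \<one> then 1 else 0)"
    by (simp add: pushforward_def G.normalized_units_one)
  also have "\<dots> = (if c = \<one>\<^bsub>H\<^esub> then 1 else 0)"
    using fin by (simp add: sum.delta)
  finally show "pushforward G h \<one>\<^bsub>normalized_units G\<^esub> c = \<one>\<^bsub>normalized_units H\<^esub> c"
    by (simp add: H.normalized_units_one)
qed

lemma pushforward_group_hom:
  assumes fin: "finite (carrier G)" "finite (carrier H)"
  shows "group_hom (normalized_units G) (normalized_units H) (pushforward G h)"
proof -
  let ?V = "normalized_units G" and ?W = "normalized_units H"
  interpret V: group ?V by (rule G.group_normalized_units[OF fin(1)])
  interpret W: group ?W by (rule H.group_normalized_units[OF fin(2)])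
  have "pushforward G h u \<in> carrier ?W" if u: "u \<in> carrier ?V" for u
  proof (rule H.normalized_unitsI[where v = "pushforward G h (inv\<^bsub>?V\<^esub> u)"])
    have "(\<Sum>c\<in>carrier H. pushforward G h u c) = (\<Sum>g\<in>carrier G. u g)"
      unfolding pushforward_def using fin by (intro sum.group) auto
    then show "(\<Sum>c\<in>carrier H. pushforward G h u c) = 1"
      using G.normalized_units_augmentation[OF u] by simp
  qed (use u in \<open>simp_all add: pushforward_outside pushforward_one[OF fin(1)] flip: pushforward_mult[OF fin]\<close>)
  then have "pushforward G h \<in> hom ?V ?W"
    by (auto simp: hom_def pushforward_mult[OF fin])
  then show ?thesis
    by (simp add: group_hom_def group_hom_axioms_def V.group_axioms W.group_axioms)
qed

lemma pushforward_coset: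
  assumes "g \<in> carrier G"
  shows "(\<Sum>n\<in>kernel G H h. u (n \<otimes> g)) = pushforward G h u (h g)"
  unfolding pushforward_def
  by (rule sum.reindex_bij_witness[where i = "\<lambda>x. x \<otimes> inv g" and j = "\<lambda>n. n \<otimes> g"])
    (use assms in \<open>auto simp: kernel_def G.m_assoc\<close>)

text \<open>For suitable \<open>K\<close> a nontrivial \<open>u\<close> equals its own power with
  exponent \<open>r ^ K\<close>, whereas no element of \<open>N - {\<one>}\<close> is such a power
  in \<open>G\<close>. The Frobenius congruence then makes the sum of \<open>u\<close> over
  \<open>N - {\<one>}\<close> divisible by \<open>r\<close>; but the trivial image and
  \<open>berman_higman\<close> make that sum 1.\<close>

lemma pushforward_trivial_imp_trivial:
  fixes r s :: nat
  assumes fin: "finite (carrier G)" "finite (carrier H)" and r: "prime r"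
    and ker: "\<And>n. n \<in> kernel G H h \<Longrightarrow> n [^] r = \<one>"
    and u: "u \<in> carrier (normalized_units G)"
    and us: "u [^]\<^bsub>normalized_units G\<^esub> s = \<one>\<^bsub>normalized_units G\<^esub>" and s: "prime s" "s \<noteq> r"
    and triv: "pushforward G h u = \<one>\<^bsub>normalized_units H\<^esub>"
  shows "u = \<one>\<^bsub>normalized_units G\<^esub>"
proof (rule ccontr)
  assume u1: "u \<noteq> \<one>\<^bsub>normalized_units G\<^esub>"
  let ?V = "normalized_units G"
  interpret V: group ?V by (rule G.group_normalized_units[OF fin(1)])
  define N where "N = kernel G H h"
  have NG: "N \<subseteq> carrier G" by (auto simp: N_def kernel_def)
  have finN: "finite N" using NG fin(1) finite_subset by blast
  have one: "\<one> \<in> N" by (simp add: N_def kernel_def)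
  \<comment> \<open>The factor \<open>s - 1\<close> makes \<open>r ^ K\<close> congruent to 1 modulo
    \<open>s\<close> by Fermat; the factor \<open>order G\<close> makes \<open>r ^ K\<close>
    divisible by the \<open>r\<close>-part of \<open>order G\<close>.\<close>
  define K where "K = (s - 1) * order G"
  have "order G > 0" using fin(1) by (simp add: G.order_gt_0_iff_finite)
  have "\<not> s dvd r" using r s primes_dvd_imp_eq by blast
  then have "[r ^ (s - 1) = 1] (mod s)" using fermat_theorem s(1) by blast
  then have "[r ^ K = 1] (mod s)" unfolding K_def power_mult by (metis cong_pow power_one)
  moreover have "r ^ K > 0" using r prime_gt_0_nat by simp
  ultimately have "s dvd r ^ K - 1" "r ^ K = 1 + (r ^ K - 1)"
    using cong_to_1_nat by auto
  then obtain t where t: "r ^ K = 1 + s * t" by (metis dvdE)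
  have uK: "u [^]\<^bsub>?V\<^esub> (r ^ K) = u"
    using u us unfolding t by (simp add: V.nat_pow_mult[symmetric] V.nat_pow_pow[symmetric])
  \<comment> \<open>The power with exponent \<open>r ^ K\<close> has order prime to
    \<open>r\<close>, but an element of \<open>N\<close> has order 1 or \<open>r\<close>.\<close>
  have no_root: "g [^] (r ^ K) = \<one>" if g: "g \<in> carrier G" "g [^] (r ^ K) \<in> N" for g
  proof -
    define x where "x = g [^] (r ^ K)"
    obtain b where b: "order G = r ^ multiplicity r (order G) * b" "\<not> r dvd b"
      using multiplicity_decompose'[of "order G" r] \<open>order G > 0\<close> r not_prime_unit by blast
    have "multiplicity r (order G) < r ^ multiplicity r (order G)"
      using r prime_gt_1_nat by (intro power_gt_expt) auto
    also have "\<dots> \<le> order G"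
      using \<open>order G > 0\<close> by (simp add: dvd_imp_le multiplicity_dvd)
    also have "\<dots> \<le> K"
    proof -
      have "1 \<le> s - 1" using prime_gt_1_nat[OF s(1)] by linarith
      then show ?thesis using mult_le_mono1[of 1 "s - 1" "order G"] by (simp only: K_def mult_1)
    qed
    finally have "r ^ multiplicity r (order G) dvd r ^ K" by (intro le_imp_power_dvd) simp
    then have "r ^ multiplicity r (order G) * b dvd r ^ K * b" by (rule mult_dvd_mono) simp
    then have "order G dvd r ^ K * b" using b(1) by simp
    then have "G.ord g dvd r ^ K * b" using G.ord_dvd_group_order[OF g(1)] dvd_trans by blast
    then have "x [^] b = \<one>"
      using g(1) by (simp add: x_def G.nat_pow_pow G.pow_eq_id)
    then have "G.ord x dvd b" using g by (simp add: x_def G.pow_eq_id)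
    moreover have "G.ord x dvd r"
      using g ker by (simp add: x_def N_def flip: G.pow_eq_id)
    ultimately have "G.ord x = 1" using b(2) r by (auto simp: prime_nat_iff)
    then show ?thesis using g G.ord_eq_1 by (simp add: x_def)
  qed
  have conj: "inv x \<otimes> c \<otimes> x \<in> N - {\<one>}" if "c \<in> N - {\<one>}" "x \<in> carrier G" for c x
  proof -
    have c: "c \<in> carrier G" using that NG by auto
    have "c = \<one>" if "inv x \<otimes> c \<otimes> x = \<one>"
    proof -
      have "c = x \<otimes> (inv x \<otimes> c \<otimes> x) \<otimes> inv x"
        using c \<open>x \<in> carrier G\<close> by (simp add: G.m_assoc) (simp flip: G.m_assoc)
      then show ?thesis using that \<open>x \<in> carrier G\<close> by simp
    qed
    then show ?thesis using that c by (auto simp: N_def kernel_def)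
  qed
  have "[(\<Sum>g\<in>N - {\<one>}. (u [^]\<^bsub>?V\<^esub> (r ^ K)) g)
      = (\<Sum>g | g \<in> carrier G \<and> g [^] (r ^ K) \<in> N - {\<one>}. u g)] (mod int r)"
    using NG conj by (intro G.iterated_frobenius_cong fin u r) auto
  moreover have "{g \<in> carrier G. g [^] (r ^ K) \<in> N - {\<one>}} = {}" using no_root by auto
  ultimately have "[(\<Sum>g\<in>N - {\<one>}. u g) = 0] (mod int r)" by (simp only: uK sum.empty)
  then have "int r dvd (\<Sum>g\<in>N - {\<one>}. u g)" by (simp add: cong_0_iff)
  moreover have "(\<Sum>g\<in>N - {\<one>}. u g) = 1"
  proof -
    have "u \<one> = 0"
      using G.berman_higman[OF fin(1) u us _ u1] s(1) prime_gt_0_nat by blast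
    then have "(\<Sum>g\<in>N - {\<one>}. u g) = (\<Sum>n\<in>N. u n)"
      using finN one by (simp add: sum.remove)
    also have "\<dots> = (\<Sum>n\<in>N. u (n \<otimes> \<one>))" using NG by (intro sum.cong) auto
    also have "\<dots> = 1"
      using pushforward_coset[of \<one> u] triv by (simp add: N_def H.normalized_units_one)
    finally show ?thesis .
  qed
  ultimately show False using r by auto
qed

end

section \<open>Commuting units\<close>

lemma (in group) prime_order_power:
  assumes "g \<in> carrier G" "ord g \<noteq> 0" "prime q" "q dvd ord g"
  obtains k :: nat where "g [^] k \<noteq> \<one>" "(g [^] k) [^] q = \<one>"
proof
  have "\<not> ord g dvd ord g div q"
    using assms prime_gt_1_nat[OF assms(3)] by (intro nat_dvd_not_less) (auto simp: dvd_div_eq_0_iff)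
  then show "g [^] (ord g div q) \<noteq> \<one>" using assms by (simp add: pow_eq_id)
  show "(g [^] (ord g div q)) [^] q = \<one>"
    using assms by (simp add: nat_pow_pow)
qed

lemma (in group) ord_eq_prime_iff:
  assumes "x \<in> carrier G" "prime p"
  shows "ord x = p \<longleftrightarrow> x \<noteq> \<one> \<and> x [^] p = \<one>"
  using assms by (metis (no_types) ord_eq_1 pow_eq_id pow_ord_eq_1 prime_nat_iff not_prime_1)

lemma (in group) commuting_pow_eq_one:
  fixes p q i :: nat
  assumes p: "prime p" and q: "prime q" and pq: "p \<noteq> q"
    and x: "x \<in> carrier G" "x [^] p = \<one>" "x \<noteq> \<one>"
    and y: "y \<in> carrier G" "y [^] q = \<one>" "y \<noteq> \<one>"
    and xy: "x \<otimes> y = y \<otimes> x" and eq: "(x \<otimes> y) [^] i = \<one>"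
  shows "p * q dvd i"
proof -
  have coprime: "coprime p q" using p q pq primes_coprime by blast
  have ord: "ord x = p" "ord y = q" using x y p q by (simp_all add: ord_eq_prime_iff)
  have *: "x [^] (i * j) \<otimes> y [^] (i * j) = \<one>" for j
    using pow_mult_distrib[OF xy x(1) y(1), of "i * j"] eq x y by (simp flip: nat_pow_pow)
  have "y [^] (i * q) = \<one>" "x [^] (i * p) = \<one>"
    using x y by (simp_all add: pow_eq_id ord)
  then have "x [^] (i * q) = \<one>" "y [^] (i * p) = \<one>"
    using *[of q] *[of p] x y by simp_all
  then have "p dvd i * q" "q dvd i * p" using x y by (simp_all add: pow_eq_id ord)
  then have "p dvd i" "q dvd i"
    using coprime by (simp_all add: coprime_dvd_mult_left_iff coprime_commute)
  then show ?thesis using coprime divides_mult by blast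
qed

text \<open>Shifting the index by \<open>q\<close> leaves \<open>c\<close> unchanged and multiplies
  the sum by the \<open>q\<close>-th power of the root of unity, which is not 1.\<close>

lemma periodic_root_sum_eq_0:
  fixes c :: "nat \<Rightarrow> complex"
  assumes "prime p" "prime q" "p \<noteq> q" "\<And>i. c (i + q) = c i"
  shows "(\<Sum>i<p * q. cis (2 * pi / real p) ^ i * c i) = 0"
proof -
  define \<xi> where "\<xi> = cis (2 * pi / real p)"
  have p0: "p > 0" using assms(1) prime_gt_0_nat by blast
  have \<xi>p: "\<xi> ^ p = 1" unfolding \<xi>_def by (rule cis_root_power[OF p0])
  have "\<not> p dvd q" using assms primes_dvd_imp_eq by blast
  then have "\<xi> ^ (q mod p) \<noteq> 1"
    unfolding \<xi>_def using p0 by (intro cis_root_power_neq_1) (auto simp: mod_greater_zero_iff_not_dvd)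
  moreover have "\<xi> ^ q = \<xi> ^ (q mod p + p * (q div p))" by simp
  then have "\<xi> ^ q = \<xi> ^ (q mod p)" by (simp only: power_add power_mult \<xi>p) simp
  ultimately have \<xi>q: "\<xi> ^ q \<noteq> 1" by simp
  have c_mult: "c (i + n * q) = c i" for i n
    by (induction n) (auto simp: assms(4) add.assoc[symmetric] add.commute[of q])
  define Z where "Z = (\<Sum>i<p * q. \<xi> ^ i * c i)"
  have "Z = (\<Sum>i<p * q. \<xi> ^ (i + q) * c (i + q))"
    unfolding Z_def by (rule sum_periodic_shift[symmetric]) (simp add: c_mult power_add power_mult \<xi>p)
  also have "\<dots> = \<xi> ^ q * Z"
    by (simp add: Z_def assms(4) power_add sum_distrib_left mult_ac)
  finally have "(1 - \<xi> ^ q) * Z = 0" by (simp add: algebra_simps)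
  then show ?thesis using \<xi>q by (simp add: Z_def \<xi>_def)
qed

context group_hom
begin

text \<open>If no nontrivial element of the kernel \<open>N\<close> commutes with a conjugate
  \<open>g\<close> of \<open>k\<close>, conjugation by \<open>N\<close> moves \<open>g\<close>
  through the coset \<open>N #> g\<close>, meeting each element once. Averaging over
  \<open>N\<close> then expresses the conjugation sum by values of the pushforward alone.\<close>

lemma conjugation_sum_eq:
  assumes fin: "finite (carrier G)" and k: "k \<in> carrier G"
    and free: "\<And>n s. n \<in> kernel G H h \<Longrightarrow> s \<in> carrier G \<Longrightarrow>
        n \<otimes> (s \<otimes> k \<otimes> inv s) = (s \<otimes> k \<otimes> inv s) \<otimes> n \<Longrightarrow> n = \<one>"
    and push: "pushforward G h v = pushforward G h w"
  shows "(\<Sum>s\<in>carrier G. v (s \<otimes> k \<otimes> inv s)) = (\<Sum>s\<in>carrier G. w (s \<otimes> k \<otimes> inv s))"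
proof -
  define N where "N = kernel G H h"
  have NG: "N \<subseteq> carrier G" by (auto simp: N_def kernel_def)
  have finN: "finite N" using NG fin finite_subset by blast
  have Npos: "card N > 0" using finN by (auto simp: N_def kernel_def card_gt_0_iff)
  have fibre: "(\<Sum>n\<in>N. v (n \<otimes> g \<otimes> inv n)) = pushforward G h v (h g)"
    if s: "s \<in> carrier G" "g = s \<otimes> k \<otimes> inv s" for g s v
  proof -
    have g: "g \<in> carrier G" using s k by simp
    \<comment> \<open>The commutator of \<open>n\<close> and \<open>g\<close> lies in
      \<open>N\<close> by normality; equal values at distinct arguments would give a nontrivial
      element of \<open>N\<close> commuting with \<open>g\<close>.\<close>
    define f where "f = (\<lambda>n. n \<otimes> g \<otimes> inv n \<otimes> inv g)"
    have fN: "f n \<in> N" if "n \<in> N" for n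
      using that g by (auto simp: N_def kernel_def f_def)
    have "inj_on f N"
    proof (rule inj_onI)
      fix n n' assume n: "n \<in> N" "n' \<in> N" "f n = f n'"
      then have nG: "n \<in> carrier G" "n' \<in> carrier G" using NG by auto
      have "n \<otimes> g \<otimes> inv n = n' \<otimes> g \<otimes> inv n'"
        using n(3) g nG by (simp add: f_def)
      then have "inv n' \<otimes> (n \<otimes> g \<otimes> inv n) \<otimes> n = inv n' \<otimes> (n' \<otimes> g \<otimes> inv n') \<otimes> n" by simp
      then have "inv n' \<otimes> n \<otimes> g = g \<otimes> (inv n' \<otimes> n)"
        using g nG by (simp add: G.m_assoc G.inv_solve_left' flip: G.m_assoc[of "inv n'" n'])
      moreover have "inv n' \<otimes> n \<in> N" using n nG by (auto simp: N_def kernel_def)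
      ultimately have "inv n' \<otimes> n = \<one>" using free s by (auto simp: N_def)
      then show "n = n'" using nG by (metis G.inv_closed G.inv_equality G.inv_inv)
    qed
    then have "bij_betw f N N"
      using finN fN by (metis bij_betw_imageI endo_inj_surj image_subsetI)
    then have "(\<Sum>n\<in>N. v (f n \<otimes> g)) = (\<Sum>n\<in>N. v (n \<otimes> g))"
      by (rule sum.reindex_bij_betw)
    moreover have "f n \<otimes> g = n \<otimes> g \<otimes> inv n" if "n \<in> N" for n
      using that NG g by (auto simp: f_def G.m_assoc)
    ultimately show ?thesis using pushforward_coset[OF g] by (simp add: N_def)
  qed
  have total: "int (card N) * (\<Sum>s\<in>carrier G. v (s \<otimes> k \<otimes> inv s))
      = (\<Sum>s\<in>carrier G. pushforward G h v (h (s \<otimes> k \<otimes> inv s)))" for v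
  proof -
    have shift: "(\<Sum>s\<in>carrier G. v (n \<otimes> (s \<otimes> k \<otimes> inv s) \<otimes> inv n))
        = (\<Sum>s\<in>carrier G. v (s \<otimes> k \<otimes> inv s))" if n: "n \<in> N" for n
    proof -
      have nG: "n \<in> carrier G" using n NG by auto
      show ?thesis
        by (rule sum.reindex_bij_witness[where i = "\<lambda>s. inv n \<otimes> s" and j = "\<lambda>s. n \<otimes> s"])
          (use nG k in \<open>auto simp: G.inv_mult_group G.m_assoc[symmetric]\<close>)
    qed
    have "int (card N) * (\<Sum>s\<in>carrier G. v (s \<otimes> k \<otimes> inv s))
        = (\<Sum>n\<in>N. \<Sum>s\<in>carrier G. v (n \<otimes> (s \<otimes> k \<otimes> inv s) \<otimes> inv n))"
      by (simp add: shift)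
    also have "\<dots> = (\<Sum>s\<in>carrier G. \<Sum>n\<in>N. v (n \<otimes> (s \<otimes> k \<otimes> inv s) \<otimes> inv n))"
      by (rule sum.swap)
    also have "\<dots> = (\<Sum>s\<in>carrier G. pushforward G h v (h (s \<otimes> k \<otimes> inv s)))"
      by (intro sum.cong refl) (simp add: fibre[OF _ refl])
    finally show ?thesis .
  qed
  have "int (card N) * (\<Sum>s\<in>carrier G. v (s \<otimes> k \<otimes> inv s))
      = int (card N) * (\<Sum>s\<in>carrier G. w (s \<otimes> k \<otimes> inv s))"
    by (simp only: total push)
  then show ?thesis using Npos by simp
qed

text \<open>
  If \<open>G\<close> had no commuting elements of orders \<open>p\<close> and \<open>q\<close>, the eigenvalue
  \<open>cis (2 * pi / p)\<close> of \<open>x \<otimes> y\<close> on the permutation module of a Sylow \<open>q\<close>-subgroup \<open>Q\<close> would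
  have multiplicity \<open>order G / (card Q * p * q)\<close>, which is not an integer.
\<close>

lemma commuting_units_imp_commuting_elements:
  fixes p q :: nat
  assumes fin: "finite (carrier G)" "finite (carrier H)"
    and p: "prime p" and q: "prime q" and pq: "p \<noteq> q"
    and ker: "\<And>n. n \<in> kernel G H h \<Longrightarrow> n [^] p = \<one>"
    and x: "x \<in> carrier (normalized_units G)" "x [^]\<^bsub>normalized_units G\<^esub> p = \<one>\<^bsub>normalized_units G\<^esub>"
      "x \<noteq> \<one>\<^bsub>normalized_units G\<^esub>"
    and y: "y \<in> carrier (normalized_units G)" "y [^]\<^bsub>normalized_units G\<^esub> q = \<one>\<^bsub>normalized_units G\<^esub>"
      "y \<noteq> \<one>\<^bsub>normalized_units G\<^esub>"
    and xy: "x \<otimes>\<^bsub>normalized_units G\<^esub> y = y \<otimes>\<^bsub>normalized_units G\<^esub> x"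
    and triv: "pushforward G h x = \<one>\<^bsub>normalized_units H\<^esub>"
  shows "\<exists>a\<in>carrier G. \<exists>b\<in>carrier G.
    a \<noteq> \<one> \<and> a [^] p = \<one> \<and> b \<noteq> \<one> \<and> b [^] q = \<one> \<and> a \<otimes> b = b \<otimes> a"
proof (rule ccontr)
  assume no: "\<not> ?thesis"
  let ?V = "normalized_units G" and ?W = "normalized_units H"
  interpret P: group_hom ?V ?W "pushforward G h" by (rule pushforward_group_hom[OF fin])
  have p0: "p > 0" and q0: "q > 0" using p q prime_gt_0_nat by auto
  have "order G > 0" using fin(1) by (simp add: G.order_gt_0_iff_finite)
  then obtain m where m: "order G = q ^ multiplicity q (order G) * m" "\<not> q dvd m"
    using multiplicity_decompose'[of "order G" q] q not_prime_unit by blast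
  define e where "e = multiplicity q (order G)"
  obtain Q where Q: "subgroup Q G" "card Q = q ^ e"
    using sylow_thm[OF q G.group_axioms _ fin(1), of e m] m(1) by (auto simp: e_def)
  have QG: "Q \<subseteq> carrier G" using Q(1) by (rule subgroup.subset)
  have finQ: "finite Q" using QG fin(1) finite_subset by blast
  define u where "u = x \<otimes>\<^bsub>?V\<^esub> y"
  have u: "u \<in> carrier ?V" using x y by (simp add: u_def)
  have u_pow: "u [^]\<^bsub>?V\<^esub> i = x [^]\<^bsub>?V\<^esub> i \<otimes>\<^bsub>?V\<^esub> y [^]\<^bsub>?V\<^esub> i" for i :: nat
    unfolding u_def using xy x(1) y(1) by (rule P.G.pow_mult_distrib)
  have ordx: "P.G.ord x = p" and ordy: "P.G.ord y = q"
    using x y p q by (simp_all add: P.G.ord_eq_prime_iff)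
  have upq: "u [^]\<^bsub>?V\<^esub> (p * q) = \<one>\<^bsub>?V\<^esub>"
  proof -
    have "x [^]\<^bsub>?V\<^esub> (p * q) = \<one>\<^bsub>?V\<^esub>" "y [^]\<^bsub>?V\<^esub> (p * q) = \<one>\<^bsub>?V\<^esub>"
      using x y by (simp_all add: P.G.pow_eq_id ordx ordy)
    then show ?thesis by (simp add: u_pow)
  qed
  have u_pow_neq: "u [^]\<^bsub>?V\<^esub> i \<noteq> \<one>\<^bsub>?V\<^esub>" if "0 < i" "i < p * q" for i
    using P.G.commuting_pow_eq_one[OF p q pq x(1,2,3) y(1,2,3) xy, of i] that
    by (auto simp: u_def nat_dvd_not_less)
  have at_one: "(u [^]\<^bsub>?V\<^esub> i) \<one> = (if i = 0 then 1 else 0)" if "i < p * q" for i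
  proof (cases "i = 0")
    case False
    have "(u [^]\<^bsub>?V\<^esub> i) [^]\<^bsub>?V\<^esub> (p * q) = \<one>\<^bsub>?V\<^esub>"
      using u upq by (metis P.G.nat_pow_one P.G.nat_pow_pow mult.commute)
    then show ?thesis
      using G.berman_higman[OF fin(1), of "u [^]\<^bsub>?V\<^esub> i" "p * q"] False u_pow_neq that p0 q0 u
      by simp
  qed (simp add: G.normalized_units_one)
  \<comment> \<open>Since \<open>x\<close> has trivial image, the images of the powers of
    \<open>u\<close> are those of the powers of \<open>y\<close> and have period
    \<open>q\<close>.\<close>
  have push_u: "pushforward G h (u [^]\<^bsub>?V\<^esub> i) = pushforward G h y [^]\<^bsub>?W\<^esub> i" for i :: nat
    using u x y triv by (simp add: P.hom_nat_pow u_def)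
  have push_per: "pushforward G h (u [^]\<^bsub>?V\<^esub> (i + q)) = pushforward G h (u [^]\<^bsub>?V\<^esub> i)" for i
  proof -
    have "pushforward G h y [^]\<^bsub>?W\<^esub> q = \<one>\<^bsub>?W\<^esub>"
      using y by (metis P.hom_nat_pow P.hom_one)
    then show ?thesis using y by (simp add: push_u flip: P.H.nat_pow_mult)
  qed
  \<comment> \<open>The share of \<open>Q - {\<one>}\<close> in the scaled trace of the
    \<open>i\<close>-th power of \<open>u\<close> on the permutation module. The identity of
    \<open>Q\<close> contributes only for \<open>i = 0\<close>.\<close>
  define c where "c = (\<lambda>i::nat. \<Sum>k\<in>Q - {\<one>}. of_int (\<Sum>s\<in>carrier G.
      (u [^]\<^bsub>?V\<^esub> i) (s \<otimes> k \<otimes> inv s)) :: complex)"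
  \<comment> \<open>As \<open>g\<close> is a nontrivial \<open>q\<close>-element, one of its powers
    has order \<open>q\<close>; a nontrivial \<open>n\<close> would have order \<open>p\<close> and
    commute with this power, against \<open>no\<close>.\<close>
  have free: "n = \<one>"
    if k: "k \<in> Q - {\<one>}" and n: "n \<in> kernel G H h" and s: "s \<in> carrier G"
      and comm: "n \<otimes> (s \<otimes> k \<otimes> inv s) = (s \<otimes> k \<otimes> inv s) \<otimes> n" for k n s
  proof -
    have kG: "k \<in> carrier G" using k QG by auto
    define g where "g = s \<otimes> k \<otimes> inv s"
    have g: "g \<in> carrier G" using s kG by (simp add: g_def)
    have nG: "n \<in> carrier G" using n by (simp add: kernel_def)
    have g_pow: "g [^] i = s \<otimes> k [^] i \<otimes> inv s" for i :: nat
      unfolding g_def using s kG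
      by (induction i) (simp_all add: G.m_assoc, simp flip: G.m_assoc)
    interpret Q: group "G\<lparr>carrier := Q\<rparr>" using Q(1) by (rule G.subgroup_imp_group)
    have "k [^] card Q = \<one>"
      using Q.pow_order_eq_1[of k] k by (simp add: order_def flip: G.nat_pow_consistent)
    then have "G.ord g dvd q ^ e"
      using s kG g by (simp add: g_pow Q(2) flip: G.pow_eq_id)
    moreover have "g \<noteq> \<one>"
    proof
      assume "g = \<one>"
      have "k = inv s \<otimes> g \<otimes> s"
        using s kG by (simp add: g_def G.m_assoc) (simp flip: G.m_assoc)
      then show False using k s by (simp add: \<open>g = \<one>\<close>)
    qed
    then have "G.ord g \<noteq> 1" using g G.ord_eq_1 by blast
    ultimately have "q dvd G.ord g"
      using q by (metis divides_primepow_nat dvd_power_same dvd_triv_left not_gr_zero power_0 power_eq_if)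
    moreover have "G.ord g \<noteq> 0"
      using G.ord_ge_1[OF fin(1) g] by simp
    ultimately obtain j :: nat where j: "g [^] j \<noteq> \<one>" "(g [^] j) [^] q = \<one>"
      using G.prime_order_power[OF g _ q] by metis
    have "g [^] j \<otimes> n = n \<otimes> g [^] j"
      using comm[folded g_def] g nG by (intro G.group_commutes_pow) auto
    then show "n = \<one>"
      using no j ker[OF n] nG g by (metis G.nat_pow_closed)
  qed
  have c_per: "c (i + q) = c i" for i
    unfolding c_def
  proof (rule sum.cong[OF refl], rule arg_cong[where f = of_int])
    fix k assume k: "k \<in> Q - {\<one>}"
    then have "k \<in> carrier G" using QG by auto
    then show "(\<Sum>s\<in>carrier G. (u [^]\<^bsub>?V\<^esub> (i + q)) (s \<otimes> k \<otimes> inv s))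
        = (\<Sum>s\<in>carrier G. (u [^]\<^bsub>?V\<^esub> i) (s \<otimes> k \<otimes> inv s))"
      using free[OF k] push_per by (rule conjugation_sum_eq[OF fin(1)])
  qed
  have \<xi>: "cis (2 * pi / real p) ^ (p * q) = 1"
    by (simp add: power_mult cis_root_power[OF p0])
  obtain k where k: "(\<Sum>i<p * q. cis (2 * pi / real p) ^ i * (\<Sum>s\<in>carrier G. \<Sum>h\<in>Q.
      of_int ((u [^]\<^bsub>?V\<^esub> i) (s \<otimes> h \<otimes> inv s)))) = of_nat (k * (p * q) * card Q)"
    using G.eigenvalue_multiplicity[OF fin(1) Q(1) u upq _ \<xi>] p0 q0 by auto
  have split: "(\<Sum>s\<in>carrier G. \<Sum>h\<in>Q. of_int ((u [^]\<^bsub>?V\<^esub> i) (s \<otimes> h \<otimes> inv s)))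
      = of_nat (order G) * of_int ((u [^]\<^bsub>?V\<^esub> i) \<one>) + c i" for i
  proof -
    have one: "\<one> \<in> Q" using Q(1) by (rule subgroup.one_closed)
    have "(\<Sum>s\<in>carrier G. \<Sum>h\<in>Q. of_int ((u [^]\<^bsub>?V\<^esub> i) (s \<otimes> h \<otimes> inv s)))
        = (\<Sum>h\<in>Q. complex_of_int (\<Sum>s\<in>carrier G. (u [^]\<^bsub>?V\<^esub> i) (s \<otimes> h \<otimes> inv s)))"
      unfolding of_int_sum by (rule sum.swap)
    also have "\<dots> = complex_of_int (\<Sum>s\<in>carrier G. (u [^]\<^bsub>?V\<^esub> i) (s \<otimes> \<one> \<otimes> inv s)) + c i"
      unfolding c_def by (rule sum.remove[OF finQ one])
    finally show ?thesis by (simp add: order_def)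
  qed
  have "of_nat (k * (p * q) * card Q)
      = (\<Sum>i<p * q. of_nat (order G) * (cis (2 * pi / real p) ^ i * of_int ((u [^]\<^bsub>?V\<^esub> i) \<one>)))
        + (\<Sum>i<p * q. cis (2 * pi / real p) ^ i * c i)"
    unfolding k[symmetric] split by (simp add: sum.distrib distrib_left mult_ac)
  also have "(\<Sum>i<p * q. cis (2 * pi / real p) ^ i * c i) = 0"
    using p q pq c_per by (rule periodic_root_sum_eq_0)
  also have "(\<Sum>i<p * q. of_nat (order G) * (cis (2 * pi / real p) ^ i * of_int ((u [^]\<^bsub>?V\<^esub> i) \<one>)))
      = (\<Sum>i<p * q. if i = 0 then of_nat (order G) else 0)"
    by (intro sum.cong refl) (simp add: at_one)
  also have "\<dots> + 0 = of_nat (order G)" using p0 q0 by simp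
  finally have "k * (p * q) * card Q = order G" by (simp only: of_nat_eq_iff)
  \<comment> \<open>Cancelling the Sylow order makes \<open>q\<close> divide the factor
    \<open>m\<close> that is prime to \<open>q\<close>.\<close>
  then have "q ^ e * (k * (p * q)) = q ^ e * m"
    using m(1) Q(2) by (simp add: e_def mult_ac)
  then have "m = k * (p * q)" using q0 by simp
  then show False using m(2) by simp
qed

end

section \<open>Normal subgroups of finite solvable groups\<close>

text \<open>\<open>k\<close> has order exactly \<open>q\<close> modulo \<open>p\<close>, so
  \<open>k ^ i - 1\<close> is invertible modulo \<open>p\<close>; its product with the sum is
  \<open>k ^ (i * q) - 1\<close>, which vanishes there. This is the orthogonality relation behind
  \<open>ex_eigenvector\<close>.\<close>

lemma geometric_sum_dvd:
  fixes p q k i :: nat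
  assumes p: "prime p" and q: "prime q"
    and k: "[k ^ q = 1] (mod p)" "\<not> [k = 1] (mod p)" and i: "0 < i" "i < q"
  shows "p dvd (\<Sum>j<q. k ^ (i * j))"
proof -
  have "ord p k dvd q" using k(1) by (simp only: ord_divides)
  moreover have "ord p k \<noteq> 1" using k(2) ord_divides[of k 1 p] by simp
  ultimately have "ord p k = q" using q by (auto simp: prime_nat_iff)
  have ki: "\<not> [k ^ i = 1] (mod p)"
  proof
    assume "[k ^ i = 1] (mod p)"
    then have "ord p k dvd i" by (simp only: ord_divides)
    then show False using \<open>ord p k = q\<close> i nat_dvd_not_less by blast
  qed
  define z where "z = int k ^ i"
  have "(z - 1) * (\<Sum>j<q. z ^ j) = z ^ q - 1"
    by (simp add: power_diff_1_eq)
  moreover have "[(k ^ q) ^ i = 1] (mod p)" using cong_pow[OF k(1), of i] by simp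
  then have "[z ^ q = 1] (mod int p)"
    unfolding z_def by (metis cong_int_iff mult.commute of_nat_1 of_nat_power power_mult)
  then have "int p dvd z ^ q - 1" by (simp add: cong_iff_dvd_diff)
  ultimately have "int p dvd (z - 1) * (\<Sum>j<q. z ^ j)" by simp
  moreover have "\<not> [z = 1] (mod int p)"
    using ki unfolding z_def by (metis cong_int_iff of_nat_1 of_nat_power)
  then have "\<not> int p dvd z - 1" by (simp add: cong_iff_dvd_diff)
  ultimately have "int p dvd (\<Sum>j<q. z ^ j)"
    using p prime_dvd_mult_iff[of "int p"] by simp
  moreover have "(\<Sum>j<q. z ^ j) = int (\<Sum>j<q. k ^ (i * j))"
    by (simp add: z_def power_mult)
  ultimately show ?thesis by (simp only: int_dvd_int_iff)
qed

context group
begin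

lemma cauchy:
  assumes "finite (carrier G)" "prime p" "p dvd order G"
  obtains x where "x \<in> carrier G" "x \<noteq> \<one>" "x [^] p = \<one>"
proof -
  obtain m where "order G = p ^ 1 * m" using assms(3) by auto
  then obtain P where P: "subgroup P G" "card P = p ^ 1"
    using sylow_thm[OF assms(2) group_axioms _ assms(1)] by blast
  interpret P: group "G\<lparr>carrier := P\<rparr>" using P(1) by (rule subgroup_imp_group)
  have "\<not> P \<subseteq> {\<one>}"
    using P(2) prime_gt_1_nat[OF assms(2)] card_mono[of "{\<one>}" P] by auto
  then obtain x where x: "x \<in> P" "x \<noteq> \<one>" by blast
  have "x [^] p = \<one>"
    using P.pow_order_eq_1[of x] x P(2) by (simp add: order_def flip: nat_pow_consistent)
  then show thesis using that[of x] x subgroup.mem_carrier[OF P(1)] by blast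
qed

text \<open>The quotient is rebuilt on chosen coset representatives inside the type of
  \<open>G\<close>: the induction over groups keeps the element type fixed, whereas cosets live in a
  type of sets.\<close>

lemma ex_quotient:
  assumes N: "N \<lhd> G"
  obtains H :: "('a, 'b) monoid_scheme" and \<phi>
  where "group_hom G H \<phi>" "\<phi> ` carrier G = carrier H" "kernel G H \<phi> = N"
proof -
  interpret N: normal N G by (rule N)
  have subN: "subgroup N G" by (rule N.subgroup_axioms)
  define \<phi> where "\<phi> = (\<lambda>g. SOME x. x \<in> N #> g)"
  have mem: "\<phi> g \<in> N #> g" if "g \<in> carrier G" for g
    unfolding \<phi>_def using rcos_self[OF that subN] by (rule someI)
  have closed: "\<phi> g \<in> carrier G" if "g \<in> carrier G" for g
    using mem[OF that] r_coset_subset_G[OF N.subset that] by blast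
  have coset: "N #> \<phi> g = N #> g" if "g \<in> carrier G" for g
    using repr_independence[OF mem[OF that] that subN] by simp
  have eq: "\<phi> a = \<phi> b \<longleftrightarrow> N #> a = N #> b" if "a \<in> carrier G" "b \<in> carrier G" for a b
  proof
    assume "\<phi> a = \<phi> b"
    then show "N #> a = N #> b" using coset[OF that(1)] coset[OF that(2)] by simp
  qed (simp add: \<phi>_def)
  \<comment> \<open>Multiplication followed by the choice of a representative; \<open>\<phi>\<close>
    respects it, so its image is a group by \<open>hom_imp_img_group\<close>.\<close>
  define H' where "H' = G\<lparr>monoid.mult := \<lambda>a b. \<phi> (a \<otimes> b)\<rparr>"
  define H where "H = H'\<lparr>carrier := \<phi> ` carrier G, one := \<phi> \<one>\<rparr>"
  have mult: "\<phi> (a \<otimes> b) = \<phi> (\<phi> a \<otimes> \<phi> b)" if "a \<in> carrier G" "b \<in> carrier G" for a b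
  proof -
    have "N #> (\<phi> a \<otimes> \<phi> b) = (N #> \<phi> a) <#> (N #> \<phi> b)"
      using that closed by (simp add: N.rcos_sum)
    also have "\<dots> = N #> (a \<otimes> b)"
      unfolding coset[OF that(1)] coset[OF that(2)] using that by (rule N.rcos_sum)
    finally show ?thesis using that closed by (subst eq) simp_all
  qed
  have "\<phi> \<in> hom G H'"
    using mult closed by (auto simp: hom_def H'_def)
  then have grp: "group H" unfolding H_def by (rule hom_imp_img_group)
  have "\<phi> \<in> hom G H"
    using mult by (auto simp: hom_def H_def H'_def)
  then have "group_hom G H \<phi>"
    using grp by (simp add: group_hom_def group_hom_axioms_def group_axioms)
  moreover have "\<phi> ` carrier G = carrier H" by (simp add: H_def)
  moreover have "kernel G H \<phi> = N"
  proof -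
    have "N #> g = N #> \<one> \<longleftrightarrow> g \<in> N" if g: "g \<in> carrier G" for g
    proof
      assume "N #> g = N #> \<one>"
      then show "g \<in> N"
        using rcos_self[OF g subN] by (simp add: coset_mult_one[OF N.subset])
    next
      assume "g \<in> N"
      then show "N #> g = N #> \<one>"
        using coset_join2[OF g subN] by (simp add: coset_mult_one[OF N.subset])
    qed
    then have "\<phi> g = \<phi> \<one> \<longleftrightarrow> g \<in> N" if "g \<in> carrier G" for g
      using that eq[OF that one_closed] by blast
    then show ?thesis
      using N.subset by (auto simp: kernel_def H_def)
  qed
  ultimately show thesis using that by blast
qed

text \<open>The last nontrivial term \<open>A\<close> of the derived series is abelian and normal.
  For a prime \<open>r\<close> dividing \<open>card A\<close>, its elements with trivial
  \<open>r\<close>-th power form a subgroup since \<open>A\<close> is abelian, and conjugation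
  preserves the equation.\<close>

lemma ex_normal_elementary_abelian:
  assumes fin: "finite (carrier G)" and "solvable G" "carrier G \<noteq> {\<one>}"
  obtains N and r :: nat where "N \<lhd> G" "prime r" "N \<noteq> {\<one>}" "\<And>n. n \<in> N \<Longrightarrow> n [^] r = \<one>"
    "\<And>a b. a \<in> N \<Longrightarrow> b \<in> N \<Longrightarrow> a \<otimes> b = b \<otimes> a"
proof -
  define D where "D = (\<lambda>n. (derived G ^^ n) (carrier G))"
  have ex: "\<exists>n. D n = {\<one>}"
    using assms(2) solvable_iff_trivial_derived_seq by (simp add: D_def)
  define n where "n = (LEAST n. D n = {\<one>})"
  have Dn: "D n = {\<one>}" unfolding n_def using ex by (rule LeastI_ex)
  have "n \<noteq> 0"
  proof
    assume "n = 0"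
    then show False using Dn assms(3) by (simp add: D_def)
  qed
  define A where "A = D (n - 1)"
  have A1: "A \<noteq> {\<one>}"
    unfolding A_def using \<open>n \<noteq> 0\<close> not_less_Least[of "n - 1" "\<lambda>n. D n = {\<one>}"] by (simp add: n_def)
  have "D i \<lhd> G" for i
    by (induction i) (simp_all add: D_def normal_self derived_is_normal)
  then have An: "A \<lhd> G" by (simp add: A_def)
  then interpret A: normal A G .
  have dA: "derived G A = {\<one>}"
  proof -
    have "D n = derived G A" unfolding A_def D_def using \<open>n \<noteq> 0\<close> by (cases n) simp_all
    then show ?thesis using Dn by simp
  qed
  have comm: "a \<otimes> b = b \<otimes> a" if "a \<in> A" "b \<in> A" for a b
  proof -
    have "a \<otimes> b \<otimes> inv a \<otimes> inv b \<in> derived_set G A" using that by blast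
    then have "a \<otimes> b \<otimes> inv a \<otimes> inv b \<in> derived G A" unfolding derived_def by (rule incl)
    then have one: "a \<otimes> b \<otimes> inv a \<otimes> inv b = \<one>" using dA by simp
    have "inv b \<otimes> (b \<otimes> a) = a" using that A.mem_carrier by (simp flip: m_assoc)
    then have "(a \<otimes> b \<otimes> inv a \<otimes> inv b) \<otimes> (b \<otimes> a) = a \<otimes> b"
      using that A.mem_carrier by (simp add: m_assoc)
    then have "a \<otimes> b = \<one> \<otimes> (b \<otimes> a)" unfolding one by (rule sym)
    also have "\<dots> = b \<otimes> a" using that A.mem_carrier by simp
    finally show ?thesis .
  qed
  have finA: "finite A" using A.subset fin finite_subset by blast
  have "card A \<noteq> 1"
    using A1 A.one_closed by (metis card_1_singletonE singletonD)
  then obtain r where r: "prime r" "r dvd card A" using prime_factor_nat by blast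
  interpret GA: group "G\<lparr>carrier := A\<rparr>" by (rule subgroup_imp_group[OF A.subgroup_axioms])
  obtain x where x: "x \<in> A" "x \<noteq> \<one>" "x [^] r = \<one>"
    using GA.cauchy[of r] r finA by (auto simp: order_def simp flip: nat_pow_consistent)
  define N where "N = {a \<in> A. a [^] r = \<one>}"
  have conj_pow: "(g \<otimes> a \<otimes> inv g) [^] i = g \<otimes> a [^] i \<otimes> inv g"
    if "a \<in> carrier G" "g \<in> carrier G" for a g and i :: nat
    using that by (induction i) (simp_all add: m_assoc, simp flip: m_assoc)
  have "subgroup N G"
  proof (rule subgroupI)
    show "N \<subseteq> carrier G" "N \<noteq> {}" using A.subset x by (auto simp: N_def)
    show "inv a \<in> N" if "a \<in> N" for a
      using that A.mem_carrier by (auto simp: N_def nat_pow_inv)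
    show "a \<otimes> b \<in> N" if "a \<in> N" "b \<in> N" for a b
      using that A.mem_carrier comm by (auto simp: N_def pow_mult_distrib)
  qed
  then have "N \<lhd> G"
    using A.inv_op_closed2 A.mem_carrier by (auto simp: normal_inv_iff N_def conj_pow)
  moreover have "N \<noteq> {\<one>}" using x by (auto simp: N_def)
  moreover have "n [^] r = \<one>" if "n \<in> N" for n using that by (simp add: N_def)
  moreover have "a \<otimes> b = b \<otimes> a" if "a \<in> N" "b \<in> N" for a b
    using that by (intro comm) (simp_all add: N_def)
  ultimately show thesis using that[of N r] r(1) by blast
qed

text \<open>The map sending \<open>n\<close> to \<open>b \<otimes> n \<otimes> inv a\<close>
  permutes \<open>N\<close> and its \<open>p\<close>-th iterate is the identity. The number of its
  fixed points is congruent to \<open>card N\<close> modulo \<open>p\<close>, hence not 0, and a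
  fixed point conjugates \<open>a\<close> to \<open>b\<close>.\<close>

lemma coprime_normal_conjugate:
  assumes fin: "finite (carrier G)" and N: "N \<lhd> G" and p: "prime p" and pN: "\<not> p dvd card N"
    and a: "a \<in> carrier G" "a [^] p = \<one>" and b: "b \<in> carrier G" "b [^] p = \<one>"
    and ab: "b \<otimes> inv a \<in> N"
  obtains n where "n \<in> N" "b \<otimes> n = n \<otimes> a"
proof -
  interpret N: normal N G by (rule N)
  have finN: "finite N" using N.subset fin finite_subset by blast
  define \<rho> where "\<rho> = (\<lambda>n. b \<otimes> n \<otimes> inv a)"
  have mem: "\<rho> n \<in> N" if "n \<in> N" for n
  proof -
    have "\<rho> n = (b \<otimes> n \<otimes> inv b) \<otimes> (b \<otimes> inv a)"
      unfolding \<rho>_def using a b N.mem_carrier[OF that] by (simp add: m_assoc) (simp flip: m_assoc)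
    then show ?thesis using that ab N.inv_op_closed2[OF b(1)] by simp
  qed
  have iter: "(\<rho> ^^ i) n = b [^] i \<otimes> n \<otimes> inv (a [^] i)" if "n \<in> N" for n i
    using that
  proof (induction i arbitrary: n)
    case (Suc i)
    have "(\<rho> ^^ Suc i) n = b [^] i \<otimes> \<rho> n \<otimes> inv (a [^] i)"
      using Suc.IH[OF mem[OF Suc.prems]] by (simp only: funpow_Suc_right o_apply)
    then show ?case
      using a b N.mem_carrier[OF Suc.prems] by (simp add: \<rho>_def m_assoc inv_mult_group)
  qed (simp add: N.mem_carrier)
  have "int p dvd (\<Sum>n\<in>N. 1) - (\<Sum>n | n \<in> N \<and> \<rho> n = n. 1)"
    using p finN mem by (rule sum_cong_sum_fixpoints)
      (use a b N.mem_carrier in \<open>auto simp: iter\<close>)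
  moreover have "\<not> int p dvd int (card N)" using pN by simp
  ultimately have "card {n \<in> N. \<rho> n = n} \<noteq> 0" by (intro notI) simp
  then have "{n \<in> N. \<rho> n = n} \<noteq> {}" by (intro notI) simp
  then obtain n where n: "n \<in> N" "b \<otimes> n \<otimes> inv a = n" unfolding \<rho>_def by blast
  have nG: "n \<in> carrier G" using n N.mem_carrier by blast
  have "b \<otimes> n = (b \<otimes> n \<otimes> inv a) \<otimes> a" using a b nG by (simp add: m_assoc)
  then show thesis using that n by simp
qed

lemma pow_cong:
  fixes a b p :: nat
  assumes "x \<in> carrier G" "x [^] p = \<one>" "[a = b] (mod p)"
  shows "x [^] a = x [^] b"
proof -
  have *: "x [^] a = x [^] (a mod p)" for a
  proof -
    have "x [^] a = x [^] (a mod p + p * (a div p))" by simp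
    also have "\<dots> = x [^] (a mod p) \<otimes> (x [^] p) [^] (a div p)"
      using assms(1) by (simp only: nat_pow_mult nat_pow_pow)
    also have "\<dots> = x [^] (a mod p)" using assms(1,2) by simp
    finally show ?thesis .
  qed
  show ?thesis using *[of a] *[of b] assms(3) by (simp add: cong_def)
qed

end

section \<open>Eigenvectors in elementary abelian groups\<close>

context comm_group
begin

text \<open>Written additively, a linear combination of the vectors \<open>t i\<close> with
  coefficients \<open>e i\<close>.\<close>

primrec weighted_product :: "(nat \<Rightarrow> 'a) \<Rightarrow> (nat \<Rightarrow> nat) \<Rightarrow> nat \<Rightarrow> 'a" where
  "weighted_product t e 0 = \<one>"
| "weighted_product t e (Suc m) = weighted_product t e m \<otimes> t m [^] e m"

lemma weighted_product_closed [simp]: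
  "(\<And>i. t i \<in> carrier G) \<Longrightarrow> weighted_product t e m \<in> carrier G"
  by (induction m) auto

lemma weighted_product_mult:
  assumes "\<And>i. t i \<in> carrier G"
  shows "weighted_product t e m \<otimes> weighted_product t e' m = weighted_product t (\<lambda>i. e i + e' i) m"
proof (induction m)
  case (Suc m)
  have "weighted_product t e (Suc m) \<otimes> weighted_product t e' (Suc m)
      = (weighted_product t e m \<otimes> weighted_product t e' m) \<otimes> (t m [^] e m \<otimes> t m [^] e' m)"
    using assms by (simp add: m_ac)
  then show ?case using assms by (simp add: Suc nat_pow_mult)
qed simp

lemma weighted_product_cong:
  "(\<And>i. i < m \<Longrightarrow> t i [^] e i = t i [^] e' i) \<Longrightarrow> weighted_product t e m = weighted_product t e' m"
  by (induction m) simp_all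

text \<open>
  The vector \<open>w j\<close> is a multiple of the projection of \<open>v\<close> to an eigenspace of \<open>T\<close>, and the
  product of all \<open>w j\<close> is \<open>v [^] q\<close>.
\<close>

lemma ex_eigenvector:
  fixes p q k :: nat
  assumes T: "T \<in> hom G G"
    and exp: "\<And>x. x \<in> carrier G \<Longrightarrow> x [^] p = \<one>"
    and p: "prime p" and q: "prime q" "p \<noteq> q"
    and k: "[k ^ q = 1] (mod p)" "\<not> [k = 1] (mod p)"
    and v: "v \<in> carrier G" "v \<noteq> \<one>" "(T ^^ q) v = v"
  obtains w j where "w \<in> carrier G" "w \<noteq> \<one>" "T w = w [^] (j::nat)"
proof -
  interpret T: group_hom G G T by (simp add: group_hom_def group_hom_axioms_def T group_axioms)
  define t where "t = (\<lambda>i. (T ^^ i) v)"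
  have tG [simp]: "t i \<in> carrier G" for i by (induction i) (auto simp: t_def v)
  have t0: "t 0 = v" "t q = v" by (simp_all add: t_def v)
  \<comment> \<open>Modulo \<open>p\<close>, \<open>k\<close> is a primitive \<open>q\<close>-th
    root of unity, so \<open>w\<close> is the discrete Fourier transform of the orbit of
    \<open>v\<close> under \<open>T\<close>.\<close>
  define w where "w = (\<lambda>j. weighted_product t (\<lambda>i. k ^ (i * j)) q)"
  have Tw: "T (weighted_product t e m) = weighted_product (\<lambda>i. t (Suc i)) e m" for e m
    by (induction m) (simp_all add: T.hom_nat_pow, simp add: t_def)
  \<comment> \<open>Applying \<open>T\<close> and scaling by \<open>k ^ j\<close> moves each term to
    the next index. Only boundary terms at 0 and \<open>m\<close> remain, and for
    \<open>m = q\<close> both equal \<open>v\<close>.\<close>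
  have telescope: "weighted_product (\<lambda>i. t (Suc i)) (\<lambda>i. k ^ (i * j)) m [^] (k ^ j) \<otimes> t 0
      = weighted_product t (\<lambda>i. k ^ (i * j)) m \<otimes> t m [^] (k ^ (m * j))" for m j
  proof (induction m)
    case (Suc m)
    let ?A = "weighted_product (\<lambda>i. t (Suc i)) (\<lambda>i. k ^ (i * j)) m"
    have "weighted_product (\<lambda>i. t (Suc i)) (\<lambda>i. k ^ (i * j)) (Suc m) [^] (k ^ j) \<otimes> t 0
        = (?A [^] (k ^ j) \<otimes> t 0) \<otimes> t (Suc m) [^] (k ^ (Suc m * j))"
      by (simp add: nat_pow_distrib nat_pow_pow m_ac power_add mult.commute)
    then show ?case unfolding Suc by simp
  qed simp
  have kqj: "[k ^ (q * j) = 1] (mod p)" for j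
    using cong_pow[OF k(1), of j] by (simp add: power_mult)
  have Tw_pow: "T (w j) [^] (k ^ j) = w j" for j
  proof -
    have "v [^] (k ^ (q * j)) = v [^] (1::nat)"
      using v exp kqj by (intro pow_cong) auto
    then have "T (w j) [^] (k ^ j) \<otimes> v = w j \<otimes> v"
      using telescope[of j q] v by (simp add: Tw w_def t0)
    then show ?thesis using v by (simp add: w_def)
  qed
  \<comment> \<open>The eigenvalue is the inverse of \<open>k ^ j\<close> modulo \<open>p\<close>,
    written with the natural exponent \<open>j * (q - 1)\<close>.\<close>
  have eigen: "T (w j) = w j [^] (k ^ (j * (q - 1)))" for j
  proof -
    have "w j [^] (k ^ (j * (q - 1))) = T (w j) [^] (k ^ j * k ^ (j * (q - 1)))"
      using Tw_pow[of j] by (metis nat_pow_pow T.hom_closed w_def weighted_product_closed tG)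
    also have "k ^ j * k ^ (j * (q - 1)) = k ^ (q * j)"
      using prime_gt_0_nat[OF q(1)] by (cases q) (simp_all flip: power_add add: algebra_simps)
    also have "T (w j) [^] (k ^ (q * j)) = T (w j) [^] (1::nat)"
      using exp kqj by (intro pow_cong) (auto simp: w_def)
    finally show ?thesis by (simp add: w_def)
  qed
  have "\<exists>j<q. w j \<noteq> \<one>"
  proof (rule ccontr)
    assume "\<not> ?thesis"
    then have w1: "w j = \<one>" if "j < q" for j using that by blast
    \<comment> \<open>Collecting the product of all \<open>w j\<close> by orbit points gives
      \<open>t i\<close> a geometric sum as exponent, divisible by \<open>p\<close> unless
      \<open>i = 0\<close>.\<close>
    have "weighted_product t (\<lambda>i. \<Sum>j<m. k ^ (i * j)) q = \<one>" if "m \<le> q" for m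
      using that
    proof (induction m)
      case 0
      have "weighted_product t (\<lambda>i. 0) n = \<one>" for n by (induction n) simp_all
      then show ?case by simp
    next
      case (Suc m)
      then show ?case
        using w1[of m] weighted_product_mult[of t "\<lambda>i. \<Sum>j<m. k ^ (i * j)" q "\<lambda>i. k ^ (i * m)"]
        by (simp add: w_def)
    qed
    then have "\<one> = weighted_product t (\<lambda>i. \<Sum>j<q. k ^ (i * j)) q" by simp
    also have "\<dots> = weighted_product t (\<lambda>i. if i = 0 then q else 0) q"
    proof (rule weighted_product_cong)
      fix i assume i: "i < q"
      have "[(\<Sum>j<q. k ^ (i * j)) = (if i = 0 then q else 0)] (mod p)"
        using geometric_sum_dvd[OF p q(1) k _ i] by (auto simp: cong_0_iff)
      then show "t i [^] (\<Sum>j<q. k ^ (i * j)) = t i [^] (if i = 0 then q else 0)"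
        using exp by (intro pow_cong) auto
    qed
    also have "weighted_product t (\<lambda>i. if i = 0 then q else 0) n = (if n = 0 then \<one> else v [^] q)" for n
      using v by (induction n) (auto simp: t0)
    finally have "v [^] q = \<one>" using prime_gt_0_nat[OF q(1)] by simp
    then have "ord v dvd q" "ord v dvd p" using v exp by (simp_all add: pow_eq_id)
    then have "ord v = 1" using p q by (metis prime_nat_iff)
    then show False using v ord_eq_1 by blast
  qed
  then show thesis using that eigen by (metis w_def weighted_product_closed tG)
qed

end

context group
begin

text \<open>Conjugation by \<open>g\<close> is a linear operator on \<open>N\<close> with trivial
  \<open>q\<close>-th power, to which \<open>ex_eigenvector\<close> applies. The number
  \<open>k\<close> certifies that the field of order \<open>p\<close> has primitive
  \<open>q\<close>-th roots of unity; the exponent \<open>j\<close> belongs to the eigenvector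
  found.\<close>

lemma ex_normalized_in_elementary_abelian:
  fixes p q k :: nat
  assumes N: "N \<lhd> G" "N \<noteq> {\<one>}"
    and comm: "\<And>a b. a \<in> N \<Longrightarrow> b \<in> N \<Longrightarrow> a \<otimes> b = b \<otimes> a"
    and exp: "\<And>n. n \<in> N \<Longrightarrow> n [^] p = \<one>"
    and p: "prime p" and q: "prime q" "p \<noteq> q"
    and k: "[k ^ q = 1] (mod p)" "\<not> [k = 1] (mod p)"
    and g: "g \<in> carrier G" "g [^] q = \<one>"
  obtains v j where "v \<in> N" "v \<noteq> \<one>" "g \<otimes> v = v [^] (j::nat) \<otimes> g"
proof -
  interpret N: normal N G by (rule N(1))
  let ?N = "G\<lparr>carrier := N\<rparr>"
  interpret A: comm_group ?N
    using subgroup_imp_group[OF N.subgroup_axioms] comm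
    by (intro group.group_comm_groupI) auto
  obtain v where v: "v \<in> N" "v \<noteq> \<one>" using N N.one_closed by blast
  define T where "T = (\<lambda>a. g \<otimes> a \<otimes> inv g)"
  have T: "T \<in> hom ?N ?N"
    using g N.mem_carrier N.inv_op_closed2
    by (auto simp: hom_def T_def m_assoc) (simp flip: m_assoc)
  have "(T ^^ i) a = g [^] i \<otimes> a \<otimes> inv (g [^] i)" if "a \<in> carrier G" for i a
    using that
  proof (induction i arbitrary: a)
    case (Suc i)
    have "T a \<in> carrier G" using g Suc.prems by (simp add: T_def)
    then have "(T ^^ Suc i) a = g [^] i \<otimes> T a \<otimes> inv (g [^] i)"
      using Suc.IH by (simp only: funpow_Suc_right o_apply)
    then show ?case
      using g Suc.prems by (simp add: T_def m_assoc inv_mult_group)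
  qed simp
  then have "(T ^^ q) v = v" using g v N.mem_carrier by simp
  then obtain w j where w: "w \<in> N" "w \<noteq> \<one>" "T w = w [^] (j::nat)"
    using A.ex_eigenvector[OF T _ p q k, of v] v exp by (auto simp flip: nat_pow_consistent)
  have "g \<otimes> w = T w \<otimes> g"
    using g N.mem_carrier[OF w(1)] by (simp add: T_def m_assoc)
  then show thesis using that w by simp
qed

end

section \<open>Arcs of the N-prime graph\<close>

text \<open>Prime orders are expressed by equations and inequations, so that a homomorphism carries
  over everything but \<open>x\<close> and \<open>y\<close> being nontrivial.\<close>

definition commuting_orders :: "('a, 'b) monoid_scheme \<Rightarrow> nat \<Rightarrow> nat \<Rightarrow> bool" where
  "commuting_orders X p q \<longleftrightarrow> (\<exists>x\<in>carrier X. \<exists>y\<in>carrier X.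
     x \<noteq> \<one>\<^bsub>X\<^esub> \<and> x [^]\<^bsub>X\<^esub> p = \<one>\<^bsub>X\<^esub> \<and> y \<noteq> \<one>\<^bsub>X\<^esub> \<and> y [^]\<^bsub>X\<^esub> q = \<one>\<^bsub>X\<^esub> \<and>
     x \<otimes>\<^bsub>X\<^esub> y = y \<otimes>\<^bsub>X\<^esub> x)"

text \<open>The witness \<open>k\<close> replaces membership in a normalizer: it passes through
  homomorphisms, and its residue modulo \<open>p\<close> decides whether \<open>x\<close> and
  \<open>y\<close> commute.\<close>

definition normalizing_orders :: "('a, 'b) monoid_scheme \<Rightarrow> nat \<Rightarrow> nat \<Rightarrow> bool" where
  "normalizing_orders X q p \<longleftrightarrow> (\<exists>x\<in>carrier X. \<exists>y\<in>carrier X. \<exists>k::nat.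
     x \<noteq> \<one>\<^bsub>X\<^esub> \<and> x [^]\<^bsub>X\<^esub> p = \<one>\<^bsub>X\<^esub> \<and> y \<noteq> \<one>\<^bsub>X\<^esub> \<and> y [^]\<^bsub>X\<^esub> q = \<one>\<^bsub>X\<^esub> \<and>
     y \<otimes>\<^bsub>X\<^esub> x = x [^]\<^bsub>X\<^esub> k \<otimes>\<^bsub>X\<^esub> y)"

lemma commuting_orders_sym: "commuting_orders X p q \<longleftrightarrow> commuting_orders X q p"
  unfolding commuting_orders_def by metis

context group
begin

lemma commuting_imp_normalizing_orders:
  assumes "commuting_orders G p q"
  shows "normalizing_orders G q p"
proof -
  obtain x y where "x \<in> carrier G" "y \<in> carrier G" "x \<noteq> \<one>" "x [^] p = \<one>" "y \<noteq> \<one>" "y [^] q = \<one>"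
      "x \<otimes> y = y \<otimes> x"
    using assms unfolding commuting_orders_def by blast
  then show ?thesis
    unfolding normalizing_orders_def by (intro bexI[of _ x] bexI[of _ y] exI[of _ 1]) simp_all
qed

lemma normalizing_pow:
  assumes "x \<in> carrier G" "y \<in> carrier G" "y \<otimes> x = x [^] (k::nat) \<otimes> y"
  shows "y \<otimes> x [^] (i::nat) = (x [^] i) [^] k \<otimes> y"
proof (induction i)
  case (Suc i)
  have "y \<otimes> x [^] Suc i = (y \<otimes> x [^] i) \<otimes> x" using assms by (simp add: m_assoc)
  also have "\<dots> = (x [^] i) [^] k \<otimes> (y \<otimes> x)" using assms Suc by (simp add: m_assoc)
  also have "\<dots> = ((x [^] i) [^] k \<otimes> x [^] k) \<otimes> y"
    using assms(1,2) by (simp add: assms(3) m_assoc)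
  also have "(x [^] i) [^] k \<otimes> x [^] k = (x [^] Suc i) [^] k"
    using assms(1) by (simp only: nat_pow_pow nat_pow_mult mult_Suc add.commute)
  finally show ?case .
qed (use assms in simp)

lemma pow_normalizing:
  assumes "x \<in> carrier G" "y \<in> carrier G" "y \<otimes> x = x [^] (k::nat) \<otimes> y"
  shows "y [^] (i::nat) \<otimes> x = x [^] (k ^ i) \<otimes> y [^] i"
proof (induction i)
  case (Suc i)
  have "y [^] Suc i \<otimes> x = y [^] i \<otimes> (y \<otimes> x)" using assms by (simp add: m_assoc)
  also have "\<dots> = y [^] i \<otimes> x [^] k \<otimes> y" using assms by (simp add: m_assoc)
  also have "y [^] i \<otimes> x [^] k = (x [^] k) [^] (k ^ i) \<otimes> y [^] i"
    using assms Suc by (intro normalizing_pow) auto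
  finally show ?case using assms by (simp add: m_assoc nat_pow_pow)
qed (use assms in simp)

lemma pow_eq_self_imp_cong:
  assumes x: "x \<in> carrier G" "x \<noteq> \<one>" "x [^] p = \<one>" and p: "prime p" and eq: "x [^] (k::nat) = x"
  shows "[k = 1] (mod p)"
proof -
  have "k \<noteq> 0" using eq x by (intro notI) simp
  then have "x [^] (k - 1) \<otimes> x = \<one> \<otimes> x"
    using eq x(1) by (cases k) simp_all
  then have "x [^] (k - 1) = \<one>" using x(1) by simp
  then have "p dvd k - 1" using x p ord_eq_prime_iff[OF x(1) p] by (simp add: pow_eq_id)
  then show ?thesis using \<open>k \<noteq> 0\<close> by (simp add: cong_altdef_nat)
qed

lemma ex_solvable_quotient:
  assumes fin: "finite (carrier G)" and solv: "solvable G" and nontriv: "carrier G \<noteq> {\<one>}"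
  obtains H :: "('a, 'b) monoid_scheme" and \<phi> and r :: nat
  where "group_hom G H \<phi>" "\<phi> ` carrier G = carrier H" "finite (carrier H)" "solvable H"
    "order H < order G" "prime r" "kernel G H \<phi> \<lhd> G" "kernel G H \<phi> \<noteq> {\<one>}"
    "\<And>n. n \<in> kernel G H \<phi> \<Longrightarrow> n [^] r = \<one>"
    "\<And>a b. a \<in> kernel G H \<phi> \<Longrightarrow> b \<in> kernel G H \<phi> \<Longrightarrow> a \<otimes> b = b \<otimes> a"
proof -
  obtain N and r :: nat where N: "N \<lhd> G" "prime r" "N \<noteq> {\<one>}" "\<And>n. n \<in> N \<Longrightarrow> n [^] r = \<one>"
      "\<And>a b. a \<in> N \<Longrightarrow> b \<in> N \<Longrightarrow> a \<otimes> b = b \<otimes> a"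
    using ex_normal_elementary_abelian[OF assms] by blast
  obtain H :: "('a, 'b) monoid_scheme" and \<phi>
    where H: "group_hom G H \<phi>" "\<phi> ` carrier G = carrier H" "kernel G H \<phi> = N"
    using ex_quotient[OF N(1)] by blast
  interpret \<phi>: group_hom G H \<phi> by (rule H(1))
  have finH: "finite (carrier H)" using H(2) fin by (metis finite_imageI)
  have "solvable H"
    using \<phi>.solvable_imp_solvable_img[of "carrier G"] solv H(2) by (simp add: solvable_def)
  moreover have "order H < order G"
  proof -
    have "order H \<le> order G" unfolding order_def H(2)[symmetric] by (rule card_image_le[OF fin])
    moreover have "order H \<noteq> order G"
    proof
      assume "order H = order G"
      then have "inj_on \<phi> (carrier G)"
        using fin H(2) by (intro eq_card_imp_inj_on) (simp_all add: order_def)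
      then have "kernel G H \<phi> = {\<one>}" using \<phi>.inj_on_one_iff by (auto simp: kernel_def)
      then show False using N(3) H(3) by simp
    qed
    ultimately show ?thesis by simp
  qed
  ultimately show thesis using that[OF H(1,2) finH _ _ N(2)] N H(3) by blast
qed

end

section \<open>Lifting arcs from a quotient\<close>

context group_hom
begin

text \<open>The product of commuting elements of orders \<open>p\<close> and \<open>q\<close> has
  order \<open>p * q\<close>, so both primes divide the order of any preimage \<open>g\<close>, and
  suitable powers of this one element commute.\<close>

lemma lift_commuting_orders:
  assumes fin: "finite (carrier G)" and surj: "h ` carrier G = carrier H"
    and p: "prime p" and q: "prime q" and pq: "p \<noteq> q" and comm: "commuting_orders H p q"
  shows "commuting_orders G p q"
proof -
  obtain a b where a: "a \<in> carrier H" "a [^]\<^bsub>H\<^esub> p = \<one>\<^bsub>H\<^esub>" "a \<noteq> \<one>\<^bsub>H\<^esub>"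
      and b: "b \<in> carrier H" "b [^]\<^bsub>H\<^esub> q = \<one>\<^bsub>H\<^esub>" "b \<noteq> \<one>\<^bsub>H\<^esub>" and ab: "a \<otimes>\<^bsub>H\<^esub> b = b \<otimes>\<^bsub>H\<^esub> a"
    using comm unfolding commuting_orders_def by blast
  have "a \<otimes>\<^bsub>H\<^esub> b \<in> h ` carrier G" using a b surj by simp
  then obtain g where g: "g \<in> carrier G" "h g = a \<otimes>\<^bsub>H\<^esub> b" by auto
  have "(a \<otimes>\<^bsub>H\<^esub> b) [^]\<^bsub>H\<^esub> G.ord g = \<one>\<^bsub>H\<^esub>"
    using g by (metis G.pow_ord_eq_1 hom_nat_pow hom_one)
  then have "p * q dvd G.ord g"
    by (rule H.commuting_pow_eq_one[OF p q pq a b ab])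
  then have dvd: "p dvd G.ord g" "q dvd G.ord g" by (auto elim: dvd_mult_left dvd_mult_right)
  have "G.ord g \<noteq> 0" using G.ord_ge_1[OF fin g(1)] by simp
  then obtain i j :: nat where "g [^] i \<noteq> \<one>" "(g [^] i) [^] p = \<one>" "g [^] j \<noteq> \<one>" "(g [^] j) [^] q = \<one>"
    using G.prime_order_power[OF g(1) _ p dvd(1)] G.prime_order_power[OF g(1) _ q dvd(2)] by metis
  moreover have "g [^] i \<otimes> g [^] j = g [^] j \<otimes> g [^] i"
    using g(1) by (simp add: G.nat_pow_mult add.commute)
  ultimately show ?thesis
    unfolding commuting_orders_def using g(1) G.nat_pow_closed by blast
qed

text \<open>A preimage of the normalizing element conjugates the lift \<open>x\<close> to an element
  that agrees with \<open>x [^] k\<close> modulo \<open>N\<close>. Both have trivial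
  \<open>p\<close>-th power and \<open>p\<close> does not divide \<open>card N\<close>, so an
  element of \<open>N\<close> conjugates one to the other and corrects the preimage.\<close>

lemma lift_normalizing_orders:
  fixes p q r :: nat
  assumes fin: "finite (carrier G)" and surj: "h ` carrier G = carrier H"
    and r: "prime r" and ker: "\<And>n. n \<in> kernel G H h \<Longrightarrow> n [^] r = \<one>"
    and p: "prime p" "p \<noteq> r" and q: "prime q" and norm: "normalizing_orders H q p"
  shows "normalizing_orders G q p"
proof -
  obtain a b k where a: "a \<in> carrier H" "a \<noteq> \<one>\<^bsub>H\<^esub>" "a [^]\<^bsub>H\<^esub> p = \<one>\<^bsub>H\<^esub>"
      and b: "b \<in> carrier H" "b \<noteq> \<one>\<^bsub>H\<^esub>" "b [^]\<^bsub>H\<^esub> q = \<one>\<^bsub>H\<^esub>"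
      and ab: "b \<otimes>\<^bsub>H\<^esub> a = a [^]\<^bsub>H\<^esub> (k::nat) \<otimes>\<^bsub>H\<^esub> b"
    using norm unfolding normalizing_orders_def by blast
  obtain x0 where x0: "x0 \<in> carrier G" "h x0 = a" using a(1) surj by (metis imageE)
  obtain y0 where y0: "y0 \<in> carrier G" "h y0 = b" using b(1) surj by (metis imageE)
  define N where "N = kernel G H h"
  have N: "N \<lhd> G" unfolding N_def by (rule normal_kernel)
  \<comment> \<open>\<open>x0 [^] p\<close> lies in the kernel, which has exponent \<open>r\<close>,
    so this power is killed by \<open>p\<close>; as \<open>p \<noteq> r\<close>, its image, the
    \<open>r\<close>-th power of \<open>a\<close>, stays nontrivial.\<close>
  define x where "x = x0 [^] r"
  have x: "x \<in> carrier G" using x0 by (simp add: x_def)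
  have hx: "h x = a [^]\<^bsub>H\<^esub> r" using x0 by (simp add: x_def hom_nat_pow)
  have "x0 [^] p \<in> kernel G H h" using x0 a by (simp add: kernel_def hom_nat_pow)
  then have xp: "x [^] p = \<one>"
    using ker x0 by (simp add: x_def G.nat_pow_pow mult.commute[of r] flip: G.nat_pow_pow[of x0 p r])
  have "\<not> p dvd r" using p r primes_dvd_imp_eq by blast
  moreover have "H.ord a = p" using a p by (simp add: H.ord_eq_prime_iff)
  ultimately have hx1: "h x \<noteq> \<one>\<^bsub>H\<^esub>" using a(1) by (simp add: hx H.pow_eq_id)
  have norm_x: "b \<otimes>\<^bsub>H\<^esub> h x = h x [^]\<^bsub>H\<^esub> k \<otimes>\<^bsub>H\<^esub> b"
    unfolding hx using a(1) b(1) ab by (rule H.normalizing_pow)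
  define z where "z = y0 \<otimes> x \<otimes> inv y0"
  have z: "z \<in> carrier G" using x y0 by (simp add: z_def)
  have z_pow: "z [^] i = y0 \<otimes> x [^] i \<otimes> inv y0" for i :: nat
    unfolding z_def using x y0(1)
    by (induction i) (simp_all add: G.m_assoc, simp flip: G.m_assoc)
  have hz: "h z = h (x [^] k)"
    using x y0 b norm_x by (simp add: z_def hom_nat_pow H.m_assoc)
  then have "x [^] k \<otimes> inv z \<in> N"
    using x z by (simp add: N_def kernel_def)
  moreover have "\<not> p dvd card N"
  proof
    assume dvd: "p dvd card N"
    have sub: "subgroup N G" using N by (rule normal_imp_subgroup)
    interpret N: group "G\<lparr>carrier := N\<rparr>" using sub by (rule G.subgroup_imp_group)
    have "finite N" using subgroup.subset[OF sub] fin finite_subset by blast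
    then obtain n where n: "n \<in> N" "n \<noteq> \<one>" "n [^] p = \<one>"
      using N.cauchy[OF _ p(1)] dvd by (auto simp: order_def simp flip: G.nat_pow_consistent)
    then have "n \<in> carrier G" "n [^] r = \<one>" using ker by (auto simp: N_def kernel_def)
    then have "G.ord n = p" "G.ord n = r" using n p r by (simp_all add: G.ord_eq_prime_iff)
    then show False using p by simp
  qed
  ultimately obtain n where n: "n \<in> N" "x [^] k \<otimes> n = n \<otimes> z"
    using G.coprime_normal_conjugate[OF fin N p(1) _ z _ _ _, of "x [^] k"] x y0 xp
    by (metis G.l_inv_ex G.m_assoc G.nat_pow_closed G.nat_pow_one G.nat_pow_pow G.r_inv G.r_one mult.commute z_pow)
  have nG: "n \<in> carrier G" using n by (simp add: N_def kernel_def)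
  define y where "y = n \<otimes> y0"
  have y: "y \<in> carrier G" using nG y0 by (simp add: y_def)
  have hy: "h y = b" using n y0 b nG by (simp add: y_def N_def kernel_def)
  have yx: "y \<otimes> x = x [^] k \<otimes> y"
  proof -
    have "y \<otimes> x = n \<otimes> z \<otimes> y0" using nG x y0 by (simp add: y_def z_def G.m_assoc)
    then show ?thesis using nG x y0 by (simp add: n(2)[symmetric] y_def G.m_assoc)
  qed
  \<comment> \<open>The order of the corrected \<open>y\<close> is only a multiple of
    \<open>q\<close>; a suitable power has order \<open>q\<close> and normalizes with exponent
    \<open>k ^ j\<close>.\<close>
  have "b [^]\<^bsub>H\<^esub> G.ord y = \<one>\<^bsub>H\<^esub>"
    using y hy by (metis G.pow_ord_eq_1 hom_nat_pow hom_one)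
  moreover have "H.ord b = q" using b q by (simp add: H.ord_eq_prime_iff)
  ultimately have "q dvd G.ord y" using b(1) by (simp add: H.pow_eq_id)
  moreover have "G.ord y \<noteq> 0" using G.ord_ge_1[OF fin y] by simp
  ultimately obtain j :: nat where j: "y [^] j \<noteq> \<one>" "(y [^] j) [^] q = \<one>"
    using G.prime_order_power[OF y _ q] by metis
  have "x \<noteq> \<one>" using hx1 by auto
  then show ?thesis
    unfolding normalizing_orders_def using x y xp j G.pow_normalizing[OF x y yx, of j]
    by (intro bexI[of _ x] bexI[of _ "y [^] j"] exI[of _ "k ^ j"]) auto
qed

end

section \<open>The induction along quotients, for commuting and for noncommuting units\<close>

lemma solvable_commuting_orders:
  fixes G :: "('a, 'b) monoid_scheme" and p q :: nat
  assumes "group G" "finite (carrier G)" "solvable G"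
    and p: "prime p" and q: "prime q" and pq: "p \<noteq> q"
    and "commuting_orders (normalized_units G) p q"
  shows "commuting_orders G p q"
  using assms(1-3,7)
proof (induction "order G" arbitrary: G rule: less_induct)
  case less
  interpret group G by fact
  note fin = less.prems(2)
  let ?V = "normalized_units G"
  interpret V: group ?V by (rule group_normalized_units[OF fin])
  obtain x y where x: "x \<in> carrier ?V" "x [^]\<^bsub>?V\<^esub> p = \<one>\<^bsub>?V\<^esub>" "x \<noteq> \<one>\<^bsub>?V\<^esub>"
      and y: "y \<in> carrier ?V" "y [^]\<^bsub>?V\<^esub> q = \<one>\<^bsub>?V\<^esub>" "y \<noteq> \<one>\<^bsub>?V\<^esub>"
      and xy: "x \<otimes>\<^bsub>?V\<^esub> y = y \<otimes>\<^bsub>?V\<^esub> x"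
    using less.prems(4) unfolding commuting_orders_def by blast
  have "p dvd order G" using unit_prime_order_dvd[OF fin x(1,2) p x(3)] .
  then have "carrier G \<noteq> {\<one>\<^bsub>G\<^esub>}" using p by (auto simp: order_def)
  then obtain H :: "('a, 'b) monoid_scheme" and \<phi> and r :: nat
    where H: "group_hom G H \<phi>" "\<phi> ` carrier G = carrier H" "finite (carrier H)" "solvable H"
      "order H < order G" and r: "prime r" "\<And>n. n \<in> kernel G H \<phi> \<Longrightarrow> n [^]\<^bsub>G\<^esub> r = \<one>\<^bsub>G\<^esub>"
    using ex_solvable_quotient[OF fin less.prems(3)] by metis
  interpret \<phi>: group_hom G H \<phi> by (rule H(1))
  let ?W = "normalized_units H"
  interpret P: group_hom ?V ?W "pushforward G \<phi>" by (rule \<phi>.pushforward_group_hom[OF fin H(3)])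
  show ?case
  proof (cases "pushforward G \<phi> x = \<one>\<^bsub>?W\<^esub>")
    case True
    then have "p = r"
      using \<phi>.pushforward_trivial_imp_trivial[OF fin H(3) r x(1,2) p] x(3) by blast
    then show ?thesis
      using \<phi>.commuting_units_imp_commuting_elements[OF fin H(3) p q pq _ x y xy True] r(2)
      unfolding commuting_orders_def by blast
  next
    case hx: False
    show ?thesis
    proof (cases "pushforward G \<phi> y = \<one>\<^bsub>?W\<^esub>")
      case True
      then have "q = r"
        using \<phi>.pushforward_trivial_imp_trivial[OF fin H(3) r y(1,2) q] y(3) by blast
      \<comment> \<open>Commuting is symmetric, so the multiplicity argument applies with the two
        primes and the two units exchanged.\<close>
      then have "commuting_orders G q p"
        using \<phi>.commuting_units_imp_commuting_elements[OF fin H(3) q p pq[symmetric] _ y x xy[symmetric] True] r(2)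
        unfolding commuting_orders_def by blast
      then show ?thesis by (simp add: commuting_orders_sym)
    next
      case False
      have "commuting_orders ?W p q"
        unfolding commuting_orders_def
      proof (intro bexI conjI)
        show "pushforward G \<phi> x [^]\<^bsub>?W\<^esub> p = \<one>\<^bsub>?W\<^esub>" "pushforward G \<phi> y [^]\<^bsub>?W\<^esub> q = \<one>\<^bsub>?W\<^esub>"
          using x y by (simp_all flip: P.hom_nat_pow)
        show "pushforward G \<phi> x \<otimes>\<^bsub>?W\<^esub> pushforward G \<phi> y = pushforward G \<phi> y \<otimes>\<^bsub>?W\<^esub> pushforward G \<phi> x"
          using x y xy by (simp flip: P.hom_mult)
      qed (use hx False x y in simp_all)
      then have "commuting_orders H p q"
        using less.hyps[OF H(5) \<phi>.H.group_axioms H(3,4)] by blast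
      then show ?thesis by (rule \<phi>.lift_commuting_orders[OF fin H(2) p q pq])
    qed
  qed
qed

text \<open>The exponent \<open>k\<close> stays fixed through the induction and is not 1 modulo
  \<open>p\<close>, so whenever the image of \<open>x\<close> is nontrivial the image of
  \<open>y\<close> is too.\<close>

lemma solvable_normalizing_orders:
  fixes G :: "('a, 'b) monoid_scheme" and p q k :: nat
  assumes "group G" "finite (carrier G)" "solvable G"
    and p: "prime p" and q: "prime q" and pq: "p \<noteq> q"
    and k: "[k ^ q = 1] (mod p)" "\<not> [k = 1] (mod p)"
    and "x \<in> carrier (normalized_units G)" "y \<in> carrier (normalized_units G)"
      "x \<noteq> \<one>\<^bsub>normalized_units G\<^esub>" "x [^]\<^bsub>normalized_units G\<^esub> p = \<one>\<^bsub>normalized_units G\<^esub>"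
      "y [^]\<^bsub>normalized_units G\<^esub> q = \<one>\<^bsub>normalized_units G\<^esub>"
      "y \<otimes>\<^bsub>normalized_units G\<^esub> x = x [^]\<^bsub>normalized_units G\<^esub> k \<otimes>\<^bsub>normalized_units G\<^esub> y"
  shows "normalizing_orders G q p"
  using assms(1-3,9-)
proof (induction "order G" arbitrary: G x y rule: less_induct)
  case less
  interpret group G by fact
  note fin = less.prems(2)
  let ?V = "normalized_units G"
  interpret V: group ?V by (rule group_normalized_units[OF fin])
  note x = less.prems(4,6,7) and y = less.prems(5,8) and yx = less.prems(9)
  have y1: "y \<noteq> \<one>\<^bsub>?V\<^esub>"
  proof
    assume "y = \<one>\<^bsub>?V\<^esub>"
    then have "x [^]\<^bsub>?V\<^esub> k = x" using yx x by simp
    then show False using V.pow_eq_self_imp_cong[OF x p] k(2) by blast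
  qed
  have dvd: "q dvd order G" using unit_prime_order_dvd[OF fin y q y1] .
  then have "carrier G \<noteq> {\<one>\<^bsub>G\<^esub>}" using q by (auto simp: order_def)
  then obtain H :: "('a, 'b) monoid_scheme" and \<phi> and r :: nat
    where H: "group_hom G H \<phi>" "\<phi> ` carrier G = carrier H" "finite (carrier H)" "solvable H"
      "order H < order G" and r: "prime r" "\<And>n. n \<in> kernel G H \<phi> \<Longrightarrow> n [^]\<^bsub>G\<^esub> r = \<one>\<^bsub>G\<^esub>"
      and N: "kernel G H \<phi> \<lhd> G" "kernel G H \<phi> \<noteq> {\<one>\<^bsub>G\<^esub>}"
        "\<And>a b. a \<in> kernel G H \<phi> \<Longrightarrow> b \<in> kernel G H \<phi> \<Longrightarrow> a \<otimes>\<^bsub>G\<^esub> b = b \<otimes>\<^bsub>G\<^esub> a"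
    using ex_solvable_quotient[OF fin less.prems(3)] by metis
  interpret \<phi>: group_hom G H \<phi> by (rule H(1))
  show ?case
  proof (cases "r = p")
    case True
    \<comment> \<open>The units enter here through \<open>k\<close> and the divisibility of
      \<open>order G\<close> by \<open>q\<close>: Cauchy's theorem supplies \<open>g\<close>, and
      the kernel supplies a subgroup of order \<open>p\<close> that it normalizes.\<close>
    obtain g where g: "g \<in> carrier G" "g \<noteq> \<one>\<^bsub>G\<^esub>" "g [^]\<^bsub>G\<^esub> q = \<one>\<^bsub>G\<^esub>"
      using cauchy[OF fin q dvd] by blast
    obtain v j where v: "v \<in> kernel G H \<phi>" "v \<noteq> \<one>\<^bsub>G\<^esub>" "g \<otimes>\<^bsub>G\<^esub> v = v [^]\<^bsub>G\<^esub> (j::nat) \<otimes>\<^bsub>G\<^esub> g"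
      using ex_normalized_in_elementary_abelian[OF N _ p q pq k g(1,3)] r(2) True by metis
    moreover have "v \<in> carrier G" "v [^]\<^bsub>G\<^esub> p = \<one>\<^bsub>G\<^esub>"
      using v r(2) True by (auto simp: kernel_def)
    ultimately show ?thesis unfolding normalizing_orders_def using g by blast
  next
    case False
    let ?W = "normalized_units H"
    interpret P: group_hom ?V ?W "pushforward G \<phi>" by (rule \<phi>.pushforward_group_hom[OF fin H(3)])
    have "pushforward G \<phi> x \<noteq> \<one>\<^bsub>?W\<^esub>"
      using \<phi>.pushforward_trivial_imp_trivial[OF fin H(3) r x(1,3) p] x(2) False by blast
    moreover have "pushforward G \<phi> x [^]\<^bsub>?W\<^esub> p = \<one>\<^bsub>?W\<^esub>" "pushforward G \<phi> y [^]\<^bsub>?W\<^esub> q = \<one>\<^bsub>?W\<^esub>"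
      using x y by (simp_all flip: P.hom_nat_pow)
    moreover have "pushforward G \<phi> y \<otimes>\<^bsub>?W\<^esub> pushforward G \<phi> x
        = pushforward G \<phi> x [^]\<^bsub>?W\<^esub> k \<otimes>\<^bsub>?W\<^esub> pushforward G \<phi> y"
      using x y yx by (simp flip: P.hom_nat_pow P.hom_mult)
    ultimately have "normalizing_orders H q p"
      using less.hyps[OF H(5) \<phi>.H.group_axioms H(3,4)] x(1) y(1) P.hom_closed by blast
    then show ?thesis
      using \<phi>.lift_normalizing_orders[OF fin H(2) r p _ q] False by blast
  qed
qed

section \<open>Translation to the graph, and the embedding of the group into its units\<close>

context group
begin

lemma mem_normalizer_iff:
  assumes x: "x \<in> carrier G" "ord x \<noteq> 0"
  shows "y \<in> normalizer G (generate G {x}) \<longleftrightarrow>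
    y \<in> carrier G \<and> (\<exists>k::nat. y \<otimes> x = x [^] k \<otimes> y)"
proof -
  define S where "S = generate G {x}"
  have S: "S = {x [^] k | k::nat. True}" unfolding S_def using generate_pow_nat[OF x] by simp
  have SG: "S \<subseteq> carrier G" using S x(1) by auto
  have conj: "y <# S #> inv y = (\<lambda>s. y \<otimes> s \<otimes> inv y) ` S" for y
    by (auto simp: l_coset_def r_coset_def)
  have mem: "y \<in> normalizer G S \<longleftrightarrow> y \<in> carrier G \<and> (\<lambda>s. y \<otimes> s \<otimes> inv y) ` S = S"
    using SG by (simp add: normalizer_def stabilizer_def conj)
  have "(\<lambda>s. y \<otimes> s \<otimes> inv y) ` S = S \<longleftrightarrow> (\<exists>k::nat. y \<otimes> x = x [^] k \<otimes> y)" if y: "y \<in> carrier G"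
  proof
    assume eq: "(\<lambda>s. y \<otimes> s \<otimes> inv y) ` S = S"
    have "x [^] (1::nat) \<in> S" unfolding S by blast
    then have "x \<in> S" using x(1) by simp
    then have "y \<otimes> x \<otimes> inv y \<in> S" using eq by blast
    then obtain k :: nat where k: "y \<otimes> x \<otimes> inv y = x [^] k" unfolding S by blast
    have "y \<otimes> x = (y \<otimes> x \<otimes> inv y) \<otimes> y" using x(1) y by (simp add: m_assoc)
    then show "\<exists>k::nat. y \<otimes> x = x [^] k \<otimes> y" unfolding k by blast
  next
    assume "\<exists>k::nat. y \<otimes> x = x [^] k \<otimes> y"
    then obtain k :: nat where k: "y \<otimes> x = x [^] k \<otimes> y" by blast
    have "y \<otimes> s \<otimes> inv y \<in> S" if "s \<in> S" for s
    proof -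
      from that obtain i :: nat where i: "s = x [^] i" unfolding S by blast
      have "y \<otimes> s \<otimes> inv y = (x [^] i) [^] k"
        unfolding i using normalizing_pow[OF x(1) y k, of i] x(1) y by (simp add: m_assoc)
      then have "y \<otimes> s \<otimes> inv y = x [^] (i * k)" using x(1) by (simp add: nat_pow_pow)
      then show ?thesis unfolding S by blast
    qed
    \<comment> \<open>The normalizer demands equality of sets; an injective map of the finite
      \<open>S\<close> into itself is onto.\<close>
    moreover have "inj_on (\<lambda>s. y \<otimes> s \<otimes> inv y) S"
      using SG y by (intro inj_onI) (simp add: subset_iff)
    moreover have "finite S"
      using generate_pow_card[OF x(1)] x(2) card.infinite unfolding S_def by metis
    ultimately show "(\<lambda>s. y \<otimes> s \<otimes> inv y) ` S = S"
      by (intro endo_inj_surj) auto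
  qed
  then show ?thesis using mem unfolding S_def by blast
qed

lemma normalizing_orders_iff:
  assumes p: "prime p" and q: "prime q"
  shows "(\<exists>x\<in>carrier G. \<exists>y\<in>carrier G. ord x = p \<and> ord y = q \<and> y \<in> normalizer G (generate G {x}))
    \<longleftrightarrow> normalizing_orders G q p"
proof -
  have "p \<noteq> 0" using p by auto
  then have "ord x = p \<and> ord y = q \<and> y \<in> normalizer G (generate G {x}) \<longleftrightarrow>
      (\<exists>k::nat. x \<noteq> \<one> \<and> x [^] p = \<one> \<and> y \<noteq> \<one> \<and> y [^] q = \<one> \<and> y \<otimes> x = x [^] k \<otimes> y)"
    if "x \<in> carrier G" "y \<in> carrier G" for x y
    using mem_normalizer_iff[of x y] ord_eq_prime_iff[OF that(1) p] ord_eq_prime_iff[OF that(2) q] that by auto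
  then show ?thesis unfolding normalizing_orders_def by (intro bex_cong refl) blast
qed

lemma N_prime_graph_eq:
  "N_prime_graph G = \<lparr>pverts = prime_spectrum G,
    parcs = {(q, p). q \<in> prime_spectrum G \<and> p \<in> prime_spectrum G \<and> q \<noteq> p \<and>
      normalizing_orders G q p}\<rparr>"
  unfolding N_prime_graph_def
proof (intro arg_cong2[where f = "\<lambda>V A. \<lparr>pverts = V, parcs = A\<rparr>"] refl Collect_cong
    prod.case_cong ext conj_cong)
  fix p q assume "q \<in> prime_spectrum G" "p \<in> prime_spectrum G"
  then have "prime p" "prime q" by (simp_all add: prime_spectrum_def)
  then show "(\<exists>x\<in>carrier G. \<exists>y\<in>carrier G. ord x = p \<and> ord y = q \<and>
      y \<in> normalizer G (generate G {x})) = normalizing_orders G q p"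
    by (rule normalizing_orders_iff)
qed

lemma mem_prime_spectrum_iff:
  "p \<in> prime_spectrum G \<longleftrightarrow> prime p \<and> (\<exists>x\<in>carrier G. x \<noteq> \<one> \<and> x [^] p = \<one>)"
  unfolding prime_spectrum_def using ord_eq_prime_iff by auto

definition trivial_unit :: "'a \<Rightarrow> 'a \<Rightarrow> int" where
  "trivial_unit a = (\<lambda>g. if g = a then 1 else 0)"

lemma trivial_unit_mult:
  assumes fin: "finite (carrier G)" and ab: "a \<in> carrier G" "b \<in> carrier G"
  shows "trivial_unit (a \<otimes> b) = trivial_unit a \<otimes>\<^bsub>normalized_units G\<^esub> trivial_unit b"
proof
  fix g
  show "trivial_unit (a \<otimes> b) g = (trivial_unit a \<otimes>\<^bsub>normalized_units G\<^esub> trivial_unit b) g"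
  proof (cases "g \<in> carrier G")
    case True
    have "(trivial_unit a \<otimes>\<^bsub>normalized_units G\<^esub> trivial_unit b) g
        = (\<Sum>h\<in>carrier G. if h = a then trivial_unit b (inv h \<otimes> g) else 0)"
      unfolding normalized_units_mult[OF fin True]
      by (intro sum.cong) (auto simp: trivial_unit_def)
    also have "\<dots> = trivial_unit b (inv a \<otimes> g)" using fin ab by simp
    also have "\<dots> = trivial_unit (a \<otimes> b) g"
      using True ab by (auto simp: trivial_unit_def m_assoc[symmetric])
    finally show ?thesis by simp
  next
    case False
    then show ?thesis
      using ab by (auto simp: normalized_units_mult_outside trivial_unit_def)
  qed
qed

lemma trivial_unit_group_hom:
  assumes fin: "finite (carrier G)"
  shows "group_hom G (normalized_units G) trivial_unit"
proof -
  interpret V: group "normalized_units G" by (rule group_normalized_units[OF fin])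
  have one: "trivial_unit \<one> = \<one>\<^bsub>normalized_units G\<^esub>"
    by (simp add: trivial_unit_def normalized_units_one)
  have "trivial_unit a \<in> carrier (normalized_units G)" if a: "a \<in> carrier G" for a
    by (rule normalized_unitsI[where v = "trivial_unit (inv a)"])
      (use a fin in \<open>auto simp: one trivial_unit_mult[symmetric],
        auto simp: trivial_unit_def\<close>)
  then show ?thesis
    using fin by (auto simp: group_hom_def group_hom_axioms_def group_axioms V.group_axioms hom_def
        trivial_unit_mult)
qed

lemma trivial_unit_eq_one: "trivial_unit a = \<one>\<^bsub>normalized_units G\<^esub> \<Longrightarrow> a = \<one>"
  by (metis normalized_units_one trivial_unit_def zero_neq_one)

end

theorem corollary2:
  fixes G (structure)
  assumes "group G" and "finite (carrier G)" and "solvable G"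
  shows "NPQ G"
proof -
  interpret group G by fact
  note fin = assms(2)
  let ?V = "normalized_units G"
  interpret V: group ?V by (rule group_normalized_units[OF fin])
  interpret T: group_hom G ?V trivial_unit by (rule trivial_unit_group_hom[OF fin])
  have spectrum: "prime_spectrum G = prime_spectrum ?V"
  proof (intro equalityI subsetI)
    fix p assume "p \<in> prime_spectrum G"
    then obtain x where "prime p" "x \<in> carrier G" "x \<noteq> \<one>" "x [^] p = \<one>"
      by (auto simp: mem_prime_spectrum_iff)
    then show "p \<in> prime_spectrum ?V"
      unfolding V.mem_prime_spectrum_iff using trivial_unit_eq_one[of x]
      by (intro conjI bexI[of _ "trivial_unit x"]) (auto simp flip: T.hom_nat_pow)
  next
    fix p assume "p \<in> prime_spectrum ?V"
    then have p: "prime p" "p dvd order G"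
      using unit_prime_order_dvd[OF fin] by (auto simp: V.mem_prime_spectrum_iff)
    then show "p \<in> prime_spectrum G"
      using cauchy[OF fin] unfolding mem_prime_spectrum_iff by metis
  qed
  have arcs: "normalizing_orders G q p \<longleftrightarrow> normalizing_orders ?V q p"
    if p: "prime p" and q: "prime q" and pq: "p \<noteq> q" for p q
  proof
    assume "normalizing_orders G q p"
    then obtain x y and k :: nat where xy: "x \<in> carrier G" "y \<in> carrier G" "x \<noteq> \<one>" "x [^] p = \<one>"
        "y \<noteq> \<one>" "y [^] q = \<one>" "y \<otimes> x = x [^] k \<otimes> y"
      unfolding normalizing_orders_def by blast
    have "trivial_unit y \<otimes>\<^bsub>?V\<^esub> trivial_unit x = trivial_unit x [^]\<^bsub>?V\<^esub> k \<otimes>\<^bsub>?V\<^esub> trivial_unit y"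
      using xy by (simp flip: T.hom_nat_pow T.hom_mult)
    then show "normalizing_orders ?V q p"
      unfolding normalizing_orders_def using xy trivial_unit_eq_one[of x] trivial_unit_eq_one[of y]
      by (intro bexI[of _ "trivial_unit x"] bexI[of _ "trivial_unit y"] exI[of _ k])
        (auto simp flip: T.hom_nat_pow)
  next
    assume "normalizing_orders ?V q p"
    then obtain x y and k :: nat where x: "x \<in> carrier ?V" "x \<noteq> \<one>\<^bsub>?V\<^esub>" "x [^]\<^bsub>?V\<^esub> p = \<one>\<^bsub>?V\<^esub>"
        and y: "y \<in> carrier ?V" "y \<noteq> \<one>\<^bsub>?V\<^esub>" "y [^]\<^bsub>?V\<^esub> q = \<one>\<^bsub>?V\<^esub>"
        and yx: "y \<otimes>\<^bsub>?V\<^esub> x = x [^]\<^bsub>?V\<^esub> k \<otimes>\<^bsub>?V\<^esub> y"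
      unfolding normalizing_orders_def by blast
    show "normalizing_orders G q p"
    \<comment> \<open>If \<open>k\<close> is 1 modulo \<open>p\<close> then \<open>x\<close> and
      \<open>y\<close> commute; otherwise \<open>k\<close> has order \<open>q\<close> modulo
      \<open>p\<close>.\<close>
    proof (cases "[k = 1] (mod p)")
      case True
      then have "x [^]\<^bsub>?V\<^esub> k = x" using V.pow_cong[OF x(1,3) True] x(1) by simp
      then have "x \<otimes>\<^bsub>?V\<^esub> y = y \<otimes>\<^bsub>?V\<^esub> x" unfolding yx by simp
      then have "commuting_orders ?V p q"
        unfolding commuting_orders_def using x y by blast
      then show ?thesis
        using solvable_commuting_orders[OF assms p q pq] commuting_imp_normalizing_orders by blast
    next
      case False
      \<comment> \<open>Conjugation by the trivial \<open>q\<close>-th power of \<open>y\<close>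
        raises \<open>x\<close> to the power \<open>k ^ q\<close>.\<close>
      have "x = y [^]\<^bsub>?V\<^esub> q \<otimes>\<^bsub>?V\<^esub> x" using x(1) by (simp add: y(3))
      also have "\<dots> = x [^]\<^bsub>?V\<^esub> (k ^ q) \<otimes>\<^bsub>?V\<^esub> y [^]\<^bsub>?V\<^esub> q"
        by (rule V.pow_normalizing[OF x(1) y(1) yx])
      also have "\<dots> = x [^]\<^bsub>?V\<^esub> (k ^ q)" using x(1) by (simp add: y(3))
      finally have "[k ^ q = 1] (mod p)" by (rule V.pow_eq_self_imp_cong[OF x p sym])
      then show ?thesis
        using solvable_normalizing_orders[OF assms p q pq _ False x(1) y(1) x(2,3) y(3) yx] by blast
    qed
  qed
  have "prime p" if "p \<in> prime_spectrum ?V" for p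
    using that by (simp add: prime_spectrum_def)
  then show ?thesis
    unfolding NPQ_def N_prime_graph_eq V.N_prime_graph_eq spectrum
    using arcs by auto
qed

end
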